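(* Every (affine) hyperplane arrangement in $\mathbb R^n$ is path convex.
   Context: A hyperplane arrangement $\mathcal A$ is a finite collection of affine hyperplanes in $\mathbb R^n$. Its regions are the closures of the connected components of $\mathbb R^n\setminus\bigcup_{H\in\mathcal A}H$; they are the maximal faces of a complete polyhedral complex $\mathcal C(\mathcal A)$. The adjacency graph $\mathcal G(\mathcal A)$ has the regions as vertices, two regions being adjacent when their intersection is $(n-1)$-dimensional. A polygon in $\mathcal G(\mathcal A)$ is the cycle formed, in cyclic order, by all regions containing a fixed codimension-2 face of $\mathcal C(\mathcal A)$. A path from $Q$ to $R$ is a sequence $R_0=Q,R_1,\dots,R_k=R$ with $R_{i-1}$---$R_i$ an edge for each $i$; its length is $k$. It is reduced if its length is minimal among paths from $Q$ to $R$. A braid move replaces a consecutive subsequence $Q_0,\dots,Q_m$ of a path by a sequence $Q_0',\dots,Q_m'$ with $Q_0'=Q_0$, $Q_m'=Q_m$ such that the cycle $Q_0,Q_1,\dots,Q_m,Q_{m-1}',\dots,Q_1',Q_0$ is a polygon in $\mathcal G(\mathcal A)$. A nil move replaces a consecutive subsequence $Q_0,Q_1,Q_2$ with $Q_0=Q_2$ by the single term $Q_0$. The arrangement $\mathcal A$ is path convex if for every pair of regions $Q,R$, every path $\gamma$ from $Q$ to $R$ and every reduced path $\rho$ from $Q$ to $R$, $\gamma$ can be transformed into $\rho$ by a sequence of braid moves and nil moves. *)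

theory Defs
  imports "HOL-Analysis.Analysis"
begin

definition affine_hyperplane :: "'a::euclidean_space set \<Rightarrow> bool" where
  "affine_hyperplane H \<longleftrightarrow> (\<exists>a b. a \<noteq> 0 \<and> H = {x. a \<bullet> x = b})"

definition hyperplane_arrangement :: "'a::euclidean_space set set \<Rightarrow> bool" where
  "hyperplane_arrangement \<A> \<longleftrightarrow> finite \<A> \<and> (\<forall>H\<in>\<A>. affine_hyperplane H)"

definition regions :: "'a::euclidean_space set set \<Rightarrow> 'a set set" where
  "regions \<A> = closure ` components (UNIV - \<Union>\<A>)"

(* The empty face is left out: aff_dim {} = -1, so in dimension 1 it would
   otherwise count as a face of codimension 2. *)
definition arrangement_complex :: "'a::euclidean_space set set \<Rightarrow> 'a set set" where
  "arrangement_complex \<A> = {F. F \<noteq> {} \<and> (\<exists>R\<in>regions \<A>. F face_of R)}"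

definition region_adj :: "'a::euclidean_space set set \<Rightarrow> 'a set \<Rightarrow> 'a set \<Rightarrow> bool" where
  "region_adj \<A> Q R \<longleftrightarrow>
     Q \<in> regions \<A> \<and> R \<in> regions \<A> \<and> aff_dim (Q \<inter> R) = int DIM('a) - 1"

(* The list contains each vertex of the cycle once; the first vertex is not repeated at the
   end. The "cyclic order" of the regions around F is the one in which each region is
   adjacent to the next. *)
definition region_polygon :: "'a::euclidean_space set set \<Rightarrow> 'a set list \<Rightarrow> bool" where
  "region_polygon \<A> c \<longleftrightarrow>
     (\<exists>F\<in>arrangement_complex \<A>. aff_dim F = int DIM('a) - 2 \<and>
        set c = {R \<in> regions \<A>. F \<subseteq> R}) \<and>
     distinct c \<and> 3 \<le> length c \<and>
     (\<forall>i<length c. region_adj \<A> (c ! i) (c ! (Suc i mod length c)))"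

definition region_path ::
  "'a::euclidean_space set set \<Rightarrow> 'a set \<Rightarrow> 'a set \<Rightarrow> 'a set list \<Rightarrow> bool" where
  "region_path \<A> Q R \<gamma> \<longleftrightarrow>
     \<gamma> \<noteq> [] \<and> hd \<gamma> = Q \<and> last \<gamma> = R \<and> set \<gamma> \<subseteq> regions \<A> \<and> successively (region_adj \<A>) \<gamma>"

definition path_len :: "'a set list \<Rightarrow> nat" where
  "path_len \<gamma> = length \<gamma> - 1"

definition reduced_path ::
  "'a::euclidean_space set set \<Rightarrow> 'a set \<Rightarrow> 'a set \<Rightarrow> 'a set list \<Rightarrow> bool" where
  "reduced_path \<A> Q R \<rho> \<longleftrightarrow>
     region_path \<A> Q R \<rho> \<and> (\<forall>\<gamma>. region_path \<A> Q R \<gamma> \<longrightarrow> path_len \<rho> \<le> path_len \<gamma>)"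

inductive braid_move :: "'a::euclidean_space set set \<Rightarrow> 'a set list \<Rightarrow> 'a set list \<Rightarrow> bool"
  for \<A> where
  "length us = length vs \<Longrightarrow> region_polygon \<A> (a # us @ b # rev vs) \<Longrightarrow>
     braid_move \<A> (xs @ (a # us @ [b]) @ ys) (xs @ (a # vs @ [b]) @ ys)"

inductive nil_move :: "'a set list \<Rightarrow> 'a set list \<Rightarrow> bool" where
  "nil_move (xs @ [a, b, a] @ ys) (xs @ [a] @ ys)"

definition path_convex :: "'a::euclidean_space set set \<Rightarrow> bool" where
  "path_convex \<A> \<longleftrightarrow>
     (\<forall>Q\<in>regions \<A>. \<forall>R\<in>regions \<A>. \<forall>\<gamma> \<rho>.
        region_path \<A> Q R \<gamma> \<longrightarrow> reduced_path \<A> Q R \<rho> \<longrightarrow>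
        (\<lambda>\<sigma> \<tau>. braid_move \<A> \<sigma> \<tau> \<or> nil_move \<sigma> \<tau>)\<^sup>*\<^sup>* \<gamma> \<rho>)"

end

theory Submission
  imports Defs
begin

text \<open>A region is determined by its sign vector, encoded below as the set of hyperplanes on whose
  positive side it lies (a tope), and two regions are adjacent iff their topes differ in one
  hyperplane. The distance of two regions is therefore the number of hyperplanes separating them.

  The heart is that any two reduced paths from \<open>Q\<close> to \<open>R\<close> are connected by
  braid moves. By induction on the distance it suffices to compare the last walls \<open>H1\<close>,
  \<open>H2\<close> they cross. Choose \<open>p1\<close>, \<open>p2\<close> on these two walls of
  \<open>R\<close> and a generic \<open>q\<close> in \<open>Q\<close>, so that the triangle
  \<open>q\<close>, \<open>p1\<close>, \<open>p2\<close> misses all flats of codimension 3. Moving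
  \<open>p\<close> from \<open>p1\<close> to \<open>p2\<close>, the last wall met by the segment from
  \<open>q\<close> to \<open>p\<close> only changes where the segment meets a codimension-2 face of
  \<open>R\<close>, and there the two last walls are related by the polygon around that face.
  In suitable projective coordinates the hyperplanes become lines over \<open>[0, 1]\<close> and the
  last walls form their lower envelope.

  An arbitrary path is reduced step by step: extending a reduced path by one region gives a reduced
  path or crosses back a hyperplane already crossed; in the latter case the reduced path may be
  replaced by one that ends by crossing this hyperplane, and a nil move applies.\<close>

subsection \<open>Generic points, lists and separation\<close>

text \<open>An intersection of dimension n - 1 would be an affine subset of full dimension in each
  hyperplane, hence equal to both.\<close>

lemma aff_dim_Int_hyperplanes_le:
  fixes a a' :: "'a::euclidean_space"
  assumes "a \<noteq> 0" "a' \<noteq> 0" "{x. a \<bullet> x = b} \<noteq> {x. a' \<bullet> x = b'}"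
  shows "aff_dim ({x. a \<bullet> x = b} \<inter> {x. a' \<bullet> x = b'}) \<le> int DIM('a) - 2"
proof (rule ccontr)
  let ?H = "{x. a \<bullet> x = b}" and ?K = "{x. a' \<bullet> x = b'}"
  assume c: "\<not> ?thesis"
  have d: "aff_dim ?H = int DIM('a) - 1" "aff_dim ?K = int DIM('a) - 1"
    using assms by (simp_all add: aff_dim_hyperplane)
  have aff: "affine ?H" "affine ?K" by (simp_all add: affine_hyperplane)
  \<comment> \<open>The negated bound makes the dimension at least \<open>DIM('a) - 1\<close>, so
    nonnegative, while the empty set has dimension -1; this covers dimension 1.\<close>
  have ne: "?H \<inter> ?K \<noteq> {}"
    using c DIM_positive[where 'a='a] by (auto simp: aff_dim_empty)
  have "aff_dim (?H \<inter> ?K) \<le> int DIM('a) - 1"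
    using aff_dim_subset[of "?H \<inter> ?K" ?H] d by auto
  then have e: "aff_dim (?H \<inter> ?K) = int DIM('a) - 1" using c by linarith
  have "?H \<inter> ?K = ?H" "?H \<inter> ?K = ?K"
    by (intro affine_dim_equal aff affine_Int ne; use d e in auto)+
  then show False using assms(3) by blast
qed

text \<open>Affine hulls of positive codimension are closed and contain no nonempty open set, so
  they can be removed from \<open>C\<close> one after another.\<close>

lemma obtains_generic_point:
  fixes C :: "'a::euclidean_space set"
  assumes "finite \<B>" "open C" "C \<noteq> {}" "\<And>B. B \<in> \<B> \<Longrightarrow> aff_dim B < int DIM('a)"
  obtains q where "q \<in> C" "\<And>B. B \<in> \<B> \<Longrightarrow> q \<notin> affine hull B"
proof -
  have "\<exists>C'\<subseteq>C. open C' \<and> C' \<noteq> {} \<and> (\<forall>B\<in>\<B>. C' \<inter> affine hull B = {})"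
    using assms(1,4)
  proof (induction \<B>)
    case empty
    then show ?case using assms by auto
  next
    case (insert B \<B>)
    then obtain C' where C': "C' \<subseteq> C" "open C'" "C' \<noteq> {}" "\<forall>B\<in>\<B>. C' \<inter> affine hull B = {}"
      by auto
    have "\<not> C' \<subseteq> affine hull B"
      using aff_dim_subset[of C' "affine hull B"] aff_dim_open[of C'] C' insert.prems[of B] by auto
    moreover have "open (C' - affine hull B)"
      using C' by (simp add: open_Diff closed_affine_hull)
    ultimately show ?case using C' by (intro exI[of _ "C' - affine hull B"]) blast
  qed
  then show ?thesis using that by blast
qed

text \<open>The sets of hyperplanes separating the regions around a codimension-2 face from a fixed one
  of them, listed in cyclic order.\<close>
lemma card_sym_diff_polygon:
  fixes hs :: "'b list"
  assumes "distinct hs" "j < 2 * length hs"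
  defines "Y \<equiv> \<lambda>j. if j \<le> length hs then set (drop j hs) else set (take (j - length hs) hs)"
  shows "card (sym_diff (Y j) (Y (Suc j))) = 1"
proof (cases "j < length hs")
  case True
  then have "drop j hs = hs ! j # drop (Suc j) hs" by (simp add: Cons_nth_drop_Suc)
  moreover from this have "hs ! j \<notin> set (drop (Suc j) hs)" using assms(1) distinct_drop[of hs j] by simp
  ultimately have "sym_diff (Y j) (Y (Suc j)) = {hs ! j}" using True unfolding Y_def by auto
  then show ?thesis by simp
next
  case False
  define i where "i = j - length hs"
  have i: "i < length hs" "j = length hs + i" using False assms by (auto simp: i_def)
  have Yj: "Y j = set (take i hs)" unfolding Y_def using i by auto
  have t: "take (Suc i) hs = take i hs @ [hs ! i]" using i by (simp add: take_Suc_conv_app_nth)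
  have YS: "Y (Suc j) = set (take (Suc i) hs)" unfolding Y_def using i by auto
  have "hs ! i \<notin> set (take i hs)" using assms(1) t distinct_take[of hs "Suc i"] by simp
  then have "sym_diff (Y j) (Y (Suc j)) = {hs ! i}" unfolding Yj YS t by auto
  then show ?thesis by simp
qed

text \<open>Within each half of the cycle the sets differ in size. Across the halves
  \<open>last hs\<close> decides: it lies in every nonempty \<open>drop\<close>, but in no
  \<open>take\<close> of fewer than \<open>length hs\<close> entries.\<close>

lemma inj_on_polygon:
  fixes hs :: "'b list"
  assumes d: "distinct hs"
  defines "Y \<equiv> \<lambda>j. if j \<le> length hs then set (drop j hs) else set (take (j - length hs) hs)"
  shows "inj_on Y {..<2 * length hs}"
proof (rule linorder_inj_onI)
  let ?k = "length hs"
  fix i j assume ij: "i < j" "i \<in> {..<2 * ?k}" "j \<in> {..<2 * ?k}"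
  have k: "hs \<noteq> []" using ij by auto
  have cd: "card (set (drop m hs)) = ?k - m" for m using d distinct_card[of "drop m hs"] by simp
  have ct: "card (set (take m hs)) = m" if "m \<le> ?k" for m
    using d distinct_card[of "take m hs"] that by simp
  consider "j \<le> ?k" | "i < ?k" "?k < j" | "i = ?k" "?k < j" | "?k < i" by linarith
  then show "Y i \<noteq> Y j"
  proof cases
    case 1
    then have "card (Y i) \<noteq> card (Y j)" using ij by (simp add: Y_def cd)
    then show ?thesis by auto
  next
    case 2
    have "last hs \<in> Y i" using 2 k by (simp add: Y_def last_drop[symmetric] del: last_drop)
    moreover have "last hs \<notin> Y j"
    proof
      assume "last hs \<in> Y j"
      then have "last hs \<in> set (take (j - ?k) hs)" using 2 by (simp add: Y_def)
      moreover have "last hs \<in> set (drop (j - ?k) hs)"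
        using 2 ij by (metis add_lessD1 last_drop last_in_set less_diff_conv2 drop_eq_Nil lessThan_iff mult_2 not_le less_imp_le)
      ultimately show False using d set_take_disj_set_drop_if_distinct[of hs "j - ?k" "j - ?k"] by auto
    qed
    ultimately show ?thesis by auto
  next
    case 3
    then have "card (Y i) \<noteq> card (Y j)" using ij by (simp add: Y_def ct)
    then show ?thesis by auto
  next
    case 4
    then have "card (Y i) \<noteq> card (Y j)" using ij by (simp add: Y_def ct)
    then show ?thesis by auto
  qed
qed auto

text \<open>Serves to read off sign patterns of hyperplanes sorted by slope as initial or final
  segments.\<close>

lemma sorted_wrt_split_take_drop:
  assumes "sorted_wrt (\<lambda>x y. P y \<longrightarrow> P x) hs"
  shows "\<exists>i\<le>length hs. {h \<in> set hs. P h} = set (take i hs) \<and> {h \<in> set hs. \<not> P h} = set (drop i hs)"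
  using assms
proof (induction hs)
  case (Cons h hs)
  then obtain i where i: "i \<le> length hs" "{h \<in> set hs. P h} = set (take i hs)"
    "{h \<in> set hs. \<not> P h} = set (drop i hs)" by auto
  show ?case
  proof (cases "P h")
    case True
    then show ?thesis using i by (intro exI[of _ "Suc i"]) auto
  next
    case False
    then show ?thesis using Cons.prems by (intro exI[of _ 0]) auto
  qed
qed simp

lemma finite_separate:
  fixes X Y :: "real set"
  assumes "finite X" "finite Y" "\<And>x y. x \<in> X \<Longrightarrow> y \<in> Y \<Longrightarrow> x < y"
  obtains c where "\<And>x. x \<in> X \<Longrightarrow> x < c" "\<And>y. y \<in> Y \<Longrightarrow> c < y"
proof -
  have X: "finite (insert (Min (insert 0 Y) - 1) X)" using assms by simp
  \<comment> \<open>The inner 0 gives \<open>Min\<close> a value when \<open>Y\<close> is empty; the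
    inserted number gives \<open>Max\<close> a value when \<open>X\<close> is empty and still lies
    below all of \<open>Y\<close>.\<close>
  define a where "a = Max (insert (Min (insert 0 Y) - 1) X)"
  have a: "\<And>x. x \<in> X \<Longrightarrow> x \<le> a" using assms(1) by (simp add: a_def)
  have aY: "a < y" if "y \<in> Y" for y
  proof -
    have "Min (insert 0 Y) \<le> y" using assms(2) that by simp
    then have "Min (insert 0 Y) - 1 < y" by linarith
    then show ?thesis using assms that unfolding a_def by (subst Max_less_iff) auto
  qed
  obtain c where "a < c" "\<And>y. y \<in> Y \<Longrightarrow> c < y"
  proof (cases "Y = {}")
    case False
    then have "a < Min Y" using aY assms(2) by simp
    then show ?thesis using that[of "(a + Min Y) / 2"] assms(2) False
      by (metis Min_le dense less_le_trans that)
  qed (use that[of "a + 1"] in simp)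
  then show ?thesis using a that[of c] by force
qed

subsection \<open>Regions as sign vectors\<close>

text \<open>A normal and an offset for each hyperplane fix which of its two sides counts as
  positive.\<close>

locale arrangement =
  fixes \<A> :: "'a::euclidean_space set set" and nrm :: "'a set \<Rightarrow> 'a" and off :: "'a set \<Rightarrow> real"
  assumes finite_arr: "finite \<A>"
    and nrm_nonzero: "H \<in> \<A> \<Longrightarrow> nrm H \<noteq> 0"
    and hyperplane_eq: "H \<in> \<A> \<Longrightarrow> {x. nrm H \<bullet> x = off H} = H"
begin

definition lv :: "'a set \<Rightarrow> 'a \<Rightarrow> real" where
  "lv H x = nrm H \<bullet> x - off H"

definition sg :: "'a set set \<Rightarrow> 'a set \<Rightarrow> real" where
  "sg T H = (if H \<in> T then 1 else -1)"

definition cell :: "'a set set \<Rightarrow> 'a set" where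
  "cell T = {x. \<forall>H\<in>\<A>. 0 < sg T H * lv H x}"

definition rg :: "'a set set \<Rightarrow> 'a set" where
  "rg T = {x. \<forall>H\<in>\<A>. 0 \<le> sg T H * lv H x}"

text \<open>\<open>cell T\<close> depends on \<open>T \<inter> \<A>\<close> only; requiring
  \<open>T \<subseteq> \<A>\<close> makes the sign vector of a region unique.\<close>

definition topes :: "'a set set set" where
  "topes = {T. T \<subseteq> \<A> \<and> cell T \<noteq> {}}"

lemma mem_hyperplane: "H \<in> \<A> \<Longrightarrow> x \<in> H \<longleftrightarrow> lv H x = 0"
  using hyperplane_eq[of H] by (auto simp: lv_def)

lemma lv_affine: "u + v = 1 \<Longrightarrow> lv H (u *\<^sub>R x + v *\<^sub>R y) = u * lv H x + v * lv H y"
proof -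
  assume "u + v = 1"
  then have "off H = u * off H + v * off H" by (metis distrib_right mult_1)
  then show ?thesis by (simp add: lv_def inner_add_right right_diff_distrib)
qed

lemma continuous_lv [continuous_intros]: "continuous_on S (lv H)"
  unfolding lv_def by (intro continuous_intros)

lemma sg_cases: "sg T H = 1 \<or> sg T H = -1"
  by (simp add: sg_def)

lemma cell_subset_rg: "cell T \<subseteq> rg T"
  by (auto simp: cell_def rg_def intro: less_imp_le)

text \<open>A positive weight on an interior point keeps every sign strict. This yields both the
  convexity of cells and the approximation of \<open>rg T\<close> from inside.\<close>

lemma cell_rg_mix:
  assumes "x \<in> cell T" "y \<in> rg T" "0 < u" "0 \<le> v" "u + v = 1"
  shows "u *\<^sub>R x + v *\<^sub>R y \<in> cell T"
  unfolding cell_def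
proof (intro CollectI ballI)
  fix H assume "H \<in> \<A>"
  then have "0 < sg T H * lv H x" "0 \<le> sg T H * lv H y"
    using assms by (auto simp: cell_def rg_def)
  then have "0 < u * (sg T H * lv H x) + v * (sg T H * lv H y)"
    using assms by (intro add_pos_nonneg mult_pos_pos[of u] mult_nonneg_nonneg[of v])
  then show "0 < sg T H * lv H (u *\<^sub>R x + v *\<^sub>R y)"
    using assms by (simp add: lv_affine algebra_simps)
qed

lemma convex_cell: "convex (cell T)"
proof (rule convexI)
  fix x y u v assume *: "x \<in> cell T" "y \<in> cell T" "(0::real) \<le> u" "0 \<le> v" "u + v = 1"
  show "u *\<^sub>R x + v *\<^sub>R y \<in> cell T"
  proof (cases "u = 0")
    case True then show ?thesis using * by simp
  next
    case False then show ?thesis using * cell_rg_mix[of x T y u v] cell_subset_rg by force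
  qed
qed

lemma rg_eq_INT: "rg T = (\<Inter>H\<in>\<A>. {x. 0 \<le> sg T H * lv H x})"
  by (auto simp: rg_def)

lemma open_cell: "open (cell T)"
proof -
  have "cell T = (\<Inter>H\<in>\<A>. {x. 0 < sg T H * lv H x})" by (auto simp: cell_def)
  then show ?thesis
    using finite_arr by (auto intro!: open_INT open_Collect_less continuous_intros)
qed

lemma closed_rg: "closed (rg T)"
  unfolding rg_eq_INT by (intro closed_INT ballI closed_Collect_le continuous_intros)

lemma convex_rg: "convex (rg T)"
proof (rule convexI)
  fix x y u v assume *: "x \<in> rg T" "y \<in> rg T" "(0::real) \<le> u" "0 \<le> v" "u + v = 1"
  show "u *\<^sub>R x + v *\<^sub>R y \<in> rg T"
    unfolding rg_def
  proof (intro CollectI ballI)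
    fix H assume "H \<in> \<A>"
    then have "0 \<le> u * (sg T H * lv H x) + v * (sg T H * lv H y)"
      using * by (auto simp: rg_def)
    then show "0 \<le> sg T H * lv H (u *\<^sub>R x + v *\<^sub>R y)"
      using * by (simp add: lv_affine algebra_simps)
  qed
qed

lemma closure_cell:
  assumes "x \<in> cell T" shows "closure (cell T) = rg T"
proof
  show "closure (cell T) \<subseteq> rg T"
    using closed_rg cell_subset_rg by (rule closure_minimal[rotated])
  show "rg T \<subseteq> closure (cell T)"
  proof
    fix y assume y: "y \<in> rg T"
    \<comment> \<open>The segment from \<open>x\<close> to \<open>y\<close> stays in the cell until
      it arrives at \<open>y\<close> for t = 0.\<close>
    have "((\<lambda>t. t *\<^sub>R x + (1 - t) *\<^sub>R y) \<longlongrightarrow> 0 *\<^sub>R x + (1 - 0) *\<^sub>R y) (at_right 0)"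
      by (intro tendsto_intros)
    moreover have "\<forall>\<^sub>F t in at_right (0::real). t *\<^sub>R x + (1 - t) *\<^sub>R y \<in> closure (cell T)"
      unfolding eventually_at_right_field
      using cell_rg_mix[OF assms y] closure_subset[of "cell T"]
      by (intro exI[of _ 1]) (auto simp del: closure_subset)
    ultimately have "0 *\<^sub>R x + (1 - 0) *\<^sub>R y \<in> closure (cell T)"
      by (intro Lim_in_closed_set[of "closure (cell T)" _ "at_right (0::real)"]) auto
    then show "y \<in> closure (cell T)" by simp
  qed
qed

lemma mem_cell_unique:
  assumes "T \<subseteq> \<A>" "T' \<subseteq> \<A>" "x \<in> cell T" "x \<in> rg T'"
  shows "T = T'"
proof -
  have "sg T H = sg T' H" if "H \<in> \<A>" for H
    using assms(3,4) that sg_cases[of T H] sg_cases[of T' H] unfolding cell_def rg_def by force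
  then have "H \<in> T \<longleftrightarrow> H \<in> T'" if "H \<in> \<A>" for H
    using that by (fastforce simp: sg_def split: if_splits)
  then show ?thesis using assms by blast
qed

lemma inj_on_rg: "inj_on rg topes"
proof (rule inj_onI)
  fix T T' assume *: "T \<in> topes" "T' \<in> topes" "rg T = rg T'"
  then obtain x where "x \<in> cell T" by (auto simp: topes_def)
  then show "T = T'" using * cell_subset_rg mem_cell_unique[of T T' x] by (auto simp: topes_def)
qed

lemma mem_cell_iff:
  assumes "x \<notin> \<Union>\<A>"
  shows "x \<in> cell T \<longleftrightarrow> (\<forall>H\<in>\<A>. H \<in> T \<longleftrightarrow> 0 < lv H x)"
proof -
  have "lv H x \<noteq> 0" if "H \<in> \<A>" for H using assms that mem_hyperplane by blast
  then show ?thesis by (force simp: cell_def sg_def)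
qed

lemma cell_disjoint_hyperplanes: "x \<in> cell T \<Longrightarrow> x \<notin> \<Union>\<A>"
  using mem_hyperplane by (force simp: cell_def)

text \<open>A cell is convex, hence connected. Conversely, by the intermediate value theorem no
  \<open>lv H\<close> changes sign on a connected set avoiding all hyperplanes.\<close>

lemma component_eq_cell:
  assumes x: "x \<in> cell T"
  shows "connected_component_set (UNIV - \<Union>\<A>) x = cell T"
proof
  show "cell T \<subseteq> connected_component_set (UNIV - \<Union>\<A>) x"
    using x convex_cell cell_disjoint_hyperplanes
    by (intro connected_component_maximal convex_connected) auto
  show "connected_component_set (UNIV - \<Union>\<A>) x \<subseteq> cell T"
  proof
    fix y assume y: "y \<in> connected_component_set (UNIV - \<Union>\<A>) x"
    let ?C = "connected_component_set (UNIV - \<Union>\<A>) x"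
    have C: "connected ?C" "?C \<subseteq> UNIV - \<Union>\<A>"
      by (auto simp: connected_component_subset connected_connected_component)
    have x': "x \<in> ?C" using x cell_disjoint_hyperplanes by (simp add: connected_component_refl_eq)
    have "0 < lv H x \<longleftrightarrow> 0 < lv H y" if H: "H \<in> \<A>" for H
    proof (rule ccontr)
      assume "\<not> ?thesis"
      then consider "lv H x \<le> 0" "0 \<le> lv H y" | "lv H y \<le> 0" "0 \<le> lv H x" by linarith
      then obtain z where "z \<in> ?C" "nrm H \<bullet> z = off H"
        using connected_ivt_hyperplane[OF C(1) x' y, of "nrm H" "off H"]
          connected_ivt_hyperplane[OF C(1) y x', of "nrm H" "off H"]
        by cases (auto simp: lv_def)
      then show False using C(2) H mem_hyperplane[OF H, of z] by (auto simp: lv_def)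
    qed
    moreover have "y \<notin> \<Union>\<A>" using y C by blast
    ultimately show "y \<in> cell T"
      using x unfolding mem_cell_iff[OF cell_disjoint_hyperplanes[OF x]] by (simp add: mem_cell_iff)
  qed
qed

lemma regions_eq: "regions \<A> = rg ` topes"
proof -
  have "\<exists>T\<in>topes. closure (connected_component_set (UNIV - \<Union>\<A>) x) = rg T"
    if "x \<in> UNIV - \<Union>\<A>" for x
  proof -
    have x: "x \<in> cell {H \<in> \<A>. 0 < lv H x}" using that mem_cell_iff by auto
    then have "{H \<in> \<A>. 0 < lv H x} \<in> topes" by (auto simp: topes_def)
    then show ?thesis using closure_cell[OF x] component_eq_cell[OF x] by metis
  qed
  moreover have "rg T \<in> regions \<A>" if "T \<in> topes" for T
  proof -
    from that obtain x where x: "x \<in> cell T" by (auto simp: topes_def)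
    then have "cell T \<in> components (UNIV - \<Union>\<A>)"
      using component_eq_cell[OF x] cell_disjoint_hyperplanes[OF x] componentsI[of x "UNIV - \<Union>\<A>"] by auto
    then show ?thesis unfolding regions_def using closure_cell[OF x] by blast
  qed
  ultimately show ?thesis unfolding regions_def components_def by blast
qed

lemma sg_sym_diff: "sg (sym_diff T S) H = (if H \<in> S then - sg T H else sg T H)"
  by (auto simp: sg_def)

lemma finite_tope: "T \<in> topes \<Longrightarrow> finite T"
  using finite_arr finite_subset by (auto simp: topes_def)

lemma aff_dim_Inter_le:
  assumes "H \<in> S" "H' \<in> S" "H \<noteq> H'" "S \<subseteq> \<A>"
  shows "aff_dim (\<Inter>S) \<le> int DIM('a) - 2"
proof -
  have "aff_dim (\<Inter>S) \<le> aff_dim (H \<inter> H')" by (rule aff_dim_subset) (use assms in auto)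
  also have "\<dots> \<le> int DIM('a) - 2"
    using aff_dim_Int_hyperplanes_le[of "nrm H" "nrm H'" "off H" "off H'"] assms
    by (metis hyperplane_eq nrm_nonzero subsetD)
  finally show ?thesis .
qed

text \<open>Join points of the two adjacent cells: only \<open>lv H\<close> changes sign along the
  way, and the point where it vanishes lies on no other hyperplane.\<close>

lemma wall_point:
  assumes "T \<in> topes" "sym_diff T {H} \<in> topes" "H \<in> \<A>"
  obtains p where "lv H p = 0" "\<And>K. K \<in> \<A> \<Longrightarrow> K \<noteq> H \<Longrightarrow> 0 < sg T K * lv K p"
proof -
  obtain x y where x: "x \<in> cell T" and y: "y \<in> cell (sym_diff T {H})"
    using assms by (auto simp: topes_def)
  \<comment> \<open>\<open>c\<close> and \<open>d\<close> measure how far \<open>x\<close> and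
    \<open>y\<close> are from \<open>H\<close> on their sides; weighting each point by the other's
    value cancels \<open>lv H\<close>.\<close>
  define c where "c = sg T H * lv H x"
  define d where "d = - (sg T H * lv H y)"
  have c: "0 < c" using x assms by (auto simp: c_def cell_def)
  have d: "0 < d" using y assms by (auto simp: d_def cell_def sg_sym_diff)
  define p where "p = (d / (c + d)) *\<^sub>R x + (c / (c + d)) *\<^sub>R y"
  have s: "d / (c + d) + c / (c + d) = 1" using c d by (simp flip: add_divide_distrib)
  have lvp: "lv K p = (d / (c + d)) * lv K x + (c / (c + d)) * lv K y" for K
    unfolding p_def using lv_affine[OF s] .
  show ?thesis
  proof
    have "sg T H * lv H p = (d / (c + d)) * c - (c / (c + d)) * d"
      unfolding lvp c_def d_def by (simp add: algebra_simps)
    then have "sg T H * lv H p = 0" by (simp add: field_simps)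
    then show "lv H p = 0" using sg_cases[of T H] by auto
    fix K assume K: "K \<in> \<A>" "K \<noteq> H"
    have "0 < sg T K * lv K x" "0 < sg (sym_diff T {H}) K * lv K y"
      using x y K by (auto simp: cell_def)
    then have "0 < sg T K * lv K x" "0 < sg T K * lv K y"
      using K unfolding sg_sym_diff by simp_all
    then have "0 < (d / (c + d)) * (sg T K * lv K x) + (c / (c + d)) * (sg T K * lv K y)"
      using c d by (intro add_pos_pos mult_pos_pos[of "d / (c + d)"] mult_pos_pos[of "c / (c + d)"]) auto
    then show "0 < sg T K * lv K p" unfolding lvp by (simp add: algebra_simps)
  qed
qed

text \<open>\<open>F\<close> contains a neighbourhood of \<open>z\<close> in the flat
  \<open>L\<close>, so it has the dimension of \<open>L\<close>. Used for walls and for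
  codimension-2 faces alike.\<close>

lemma aff_dim_local:
  assumes "affine L" "z \<in> L" "\<And>K. K \<in> S \<Longrightarrow> 0 < c K * lv K z" "S \<subseteq> \<A>"
    "L \<inter> {x. \<forall>K\<in>S. 0 < c K * lv K x} \<subseteq> F" "F \<subseteq> L"
  shows "aff_dim F = aff_dim L"
proof -
  let ?U = "{x. \<forall>K\<in>S. 0 < c K * lv K x}"
  have "?U = (\<Inter>K\<in>S. {x. 0 < c K * lv K x})" by auto
  then have o: "open ?U"
    using finite_subset[OF assms(4) finite_arr]
    by (auto intro!: open_INT open_Collect_less continuous_intros)
  have "aff_dim (L \<inter> ?U) = aff_dim L"
    using assms by (intro aff_dim_convex_Int_open affine_imp_convex o) auto
  then show ?thesis
    using aff_dim_subset[OF assms(5)] aff_dim_subset[OF assms(6)] by linarith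
qed

text \<open>The intersection of two regions lies in every hyperplane separating them: two such
  hyperplanes make it too small, none makes it full-dimensional. With exactly one, it contains a
  neighbourhood of a wall point in that hyperplane.\<close>

lemma region_adj_rg:
  assumes T: "T \<in> topes" and T': "T' \<in> topes"
  shows "region_adj \<A> (rg T) (rg T') \<longleftrightarrow> card (sym_diff T T') = 1"
proof
  have sub: "T \<subseteq> \<A>" "T' \<subseteq> \<A>" using T T' by (auto simp: topes_def)
  assume adj: "region_adj \<A> (rg T) (rg T')"
  have le: "rg T \<inter> rg T' \<subseteq> \<Inter>(sym_diff T T')"
  proof safe
    fix x H assume "x \<in> rg T" "x \<in> rg T'" and H: "H \<in> T" "H \<notin> T'"
    then show "x \<in> H" using sub mem_hyperplane[of H x] unfolding rg_def sg_def by force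
  next
    fix x H assume "x \<in> rg T" "x \<in> rg T'" and H: "H \<notin> T" "H \<in> T'"
    then show "x \<in> H" using sub mem_hyperplane[of H x] unfolding rg_def sg_def by force
  qed
  have "sym_diff T T' \<noteq> {}"
  proof
    assume "sym_diff T T' = {}"
    then have eq: "T = T'" by auto
    obtain x where "x \<in> cell T" using T by (auto simp: topes_def)
    then have "aff_dim (cell T) = int DIM('a)" using aff_dim_open[OF open_cell] by auto
    then have "int DIM('a) \<le> aff_dim (rg T)" using aff_dim_subset[OF cell_subset_rg, of T] by simp
    then show False using adj eq by (simp add: region_adj_def)
  qed
  moreover have "\<not> (\<exists>H K. H \<in> sym_diff T T' \<and> K \<in> sym_diff T T' \<and> H \<noteq> K)"
  proof
    assume "\<exists>H K. H \<in> sym_diff T T' \<and> K \<in> sym_diff T T' \<and> H \<noteq> K"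
    then obtain H K where "H \<in> sym_diff T T'" "K \<in> sym_diff T T'" "H \<noteq> K" by blast
    then have "aff_dim (\<Inter>(sym_diff T T')) \<le> int DIM('a) - 2"
      using sub by (intro aff_dim_Inter_le[of H _ K]) auto
    then show False using aff_dim_subset[OF le] adj by (simp add: region_adj_def)
  qed
  ultimately have "is_singleton (sym_diff T T')" by (metis is_singletonI')
  then show "card (sym_diff T T') = 1" by (simp add: is_singleton_altdef)
next
  assume "card (sym_diff T T') = 1"
  then obtain H where H: "sym_diff T T' = {H}" by (elim card_1_singletonE)
  then have eq: "T' = sym_diff T {H}" by blast
  have HA: "H \<in> \<A>" using H T T' by (auto simp: topes_def)
  obtain p where p: "lv H p = 0" "\<And>K. K \<in> \<A> \<Longrightarrow> K \<noteq> H \<Longrightarrow> 0 < sg T K * lv K p"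
    using wall_point[OF T T'[unfolded eq] HA] by blast
  have aff: "affine H" using hyperplane_eq[OF HA] affine_hyperplane[of "nrm H" "off H"] by simp
  have "aff_dim (rg T \<inter> rg T') = aff_dim H"
  proof (rule aff_dim_local[of H p "\<A> - {H}" "sg T"])
    show "H \<inter> {x. \<forall>K\<in>\<A> - {H}. 0 < sg T K * lv K x} \<subseteq> rg T \<inter> rg T'"
    proof
      fix x assume x: "x \<in> H \<inter> {x. \<forall>K\<in>\<A> - {H}. 0 < sg T K * lv K x}"
      then have "0 \<le> sg T K * lv K x \<and> 0 \<le> sg T' K * lv K x" if "K \<in> \<A>" for K
        using x mem_hyperplane[OF HA] that unfolding eq sg_sym_diff by (cases "K = H") (simp_all add: less_imp_le)
      then show "x \<in> rg T \<inter> rg T'" by (auto simp: rg_def)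
    qed
    show "rg T \<inter> rg T' \<subseteq> H"
    proof
      fix x assume "x \<in> rg T \<inter> rg T'"
      then have "0 \<le> sg T H * lv H x" "0 \<le> sg (sym_diff T {H}) H * lv H x"
        using HA unfolding eq rg_def by blast+
      moreover have "sg (sym_diff T {H}) H * lv H x = - (sg T H * lv H x)"
        unfolding sg_sym_diff by simp
      ultimately have "sg T H * lv H x = 0" by linarith
      then have "lv H x = 0" using sg_cases[of T H] by auto
      then show "x \<in> H" using mem_hyperplane[OF HA] by blast
    qed
    show "affine H" by (fact aff)
    show "p \<in> H" using p(1) mem_hyperplane[OF HA] by blast
    show "0 < sg T K * lv K p" if "K \<in> \<A> - {H}" for K using p(2) that by blast
  qed blast
  moreover have "aff_dim H = int DIM('a) - 1"
    using aff_dim_hyperplane[OF nrm_nonzero[OF HA], of "off H"] hyperplane_eq[OF HA] by simp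
  ultimately show "region_adj \<A> (rg T) (rg T')"
    using T T' by (simp add: region_adj_def regions_eq)
qed

subsection \<open>Paths and polygons\<close>

abbreviation moves :: "'a set list \<Rightarrow> 'a set list \<Rightarrow> bool" where
  "moves \<equiv> (\<lambda>\<sigma> \<tau>. braid_move \<A> \<sigma> \<tau> \<or> nil_move \<sigma> \<tau>)\<^sup>*\<^sup>*"

definition tpath :: "'a set set \<Rightarrow> 'a set set \<Rightarrow> 'a set set list \<Rightarrow> bool" where
  "tpath Q R \<tau> \<longleftrightarrow> \<tau> \<noteq> [] \<and> hd \<tau> = Q \<and> last \<tau> = R \<and> set \<tau> \<subseteq> topes \<and>
     successively (\<lambda>T T'. card (sym_diff T T') = 1) \<tau>"

text \<open>These will be the reduced paths: by \<open>tpath_length\<close> no path is shorter, and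
  by \<open>exists_geod\<close> the length is attained. The \<open>Suc\<close> is there because the
  list counts regions, not steps.\<close>

definition geod :: "'a set set \<Rightarrow> 'a set set \<Rightarrow> 'a set set list \<Rightarrow> bool" where
  "geod Q R \<tau> \<longleftrightarrow> tpath Q R \<tau> \<and> length \<tau> = Suc (card (sym_diff Q R))"

lemma braid_move_append:
  assumes "braid_move \<A> \<sigma> \<tau>" shows "braid_move \<A> (xs @ \<sigma> @ ys) (xs @ \<tau> @ ys)"
  using assms
proof cases
  case (1 us vs a b xs' ys')
  then show ?thesis using braid_move.intros[of us vs \<A> a b "xs @ xs'" "ys' @ ys"] by simp
qed

lemma nil_move_append:
  assumes "nil_move \<sigma> \<tau>" shows "nil_move (xs @ \<sigma> @ ys) (xs @ \<tau> @ ys)"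
  using assms
proof cases
  case (1 xs' a b ys')
  then show ?thesis using nil_move.intros[of "xs @ xs'" a b "ys' @ ys"] by simp
qed

lemma moves_append: "moves \<sigma> \<tau> \<Longrightarrow> moves (xs @ \<sigma> @ ys) (xs @ \<tau> @ ys)"
proof (induction rule: rtranclp_induct)
  case (step \<tau> \<tau>')
  then show ?case
    using braid_move_append[of \<tau> \<tau>' xs ys] nil_move_append[of \<tau> \<tau>' xs ys]
    by (elim rtranclp.rtrancl_into_rtrancl) blast
qed simp

lemma moves_snoc: "moves (map rg \<sigma>) (map rg \<tau>) \<Longrightarrow> moves (map rg (\<sigma> @ ys)) (map rg (\<tau> @ ys))"
  using moves_append[of "map rg \<sigma>" "map rg \<tau>" "[]" "map rg ys"] by simp

lemma region_path_rg:
  assumes "Q \<in> topes" "R \<in> topes" "set \<tau> \<subseteq> topes"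
  shows "region_path \<A> (rg Q) (rg R) (map rg \<tau>) \<longleftrightarrow> tpath Q R \<tau>"
proof (cases "\<tau> = []")
  case False
  have "successively (region_adj \<A>) (map rg \<tau>) \<longleftrightarrow> successively (\<lambda>T T'. card (sym_diff T T') = 1) \<tau>"
    unfolding successively_map using assms(3)
    by (intro successively_cong) (auto simp only: region_adj_rg subset_iff)
  moreover have "rg (hd \<tau>) = rg Q \<longleftrightarrow> hd \<tau> = Q" "rg (last \<tau>) = rg R \<longleftrightarrow> last \<tau> = R"
    using assms False by (auto intro!: inj_on_eq_iff[OF inj_on_rg] hd_in_set last_in_set)
  ultimately show ?thesis
    using assms(3) False
    by (auto simp: region_path_def tpath_def hd_map last_map regions_eq)
qed (simp add: region_path_def tpath_def)

lemma lift_region_path: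
  assumes "region_path \<A> (rg Q) (rg R) \<gamma>"
  obtains \<tau> where "set \<tau> \<subseteq> topes" "\<gamma> = map rg \<tau>"
proof -
  have "\<gamma> \<in> lists (rg ` topes)" using assms by (auto simp: region_path_def regions_eq)
  then obtain \<tau> where "\<tau> \<in> lists topes" "\<gamma> = map rg \<tau>" by (auto simp: lists_image)
  then show ?thesis using that by auto
qed

lemma finite_sym_diff_topes: "T \<in> topes \<Longrightarrow> T' \<in> topes \<Longrightarrow> finite (sym_diff T T')"
  using finite_tope by auto

lemma card_sym_diff_triangle:
  assumes "Q \<in> topes" "S \<in> topes" "R \<in> topes"
  shows "card (sym_diff Q R) \<le> card (sym_diff Q S) + card (sym_diff S R)"
proof -
  have "card (sym_diff Q R) \<le> card (sym_diff Q S \<union> sym_diff S R)"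
    using assms finite_sym_diff_topes by (intro card_mono) auto
  then show ?thesis using card_Un_le order_trans by blast
qed

lemma tpath_snoc:
  assumes "tpath Q S \<sigma>" "R \<in> topes" "card (sym_diff S R) = 1"
  shows "tpath Q R (\<sigma> @ [R])"
  using assms by (auto simp: tpath_def successively_append_iff)

lemma tpath_butlast:
  assumes "tpath Q R (\<sigma> @ [R'])" "\<sigma> \<noteq> []"
  shows "R' = R" "tpath Q (last \<sigma>) \<sigma>" "card (sym_diff (last \<sigma>) R) = 1" "last \<sigma> \<in> topes"
  using assms by (auto simp: tpath_def successively_append_iff)

lemma tpath_ends: "tpath Q R \<sigma> \<Longrightarrow> Q \<in> topes \<and> R \<in> topes"
  unfolding tpath_def by (metis hd_in_set last_in_set subsetD)

text \<open>By the triangle inequality each step raises the distance from \<open>Q\<close> by at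
  most one.\<close>

lemma tpath_length:
  "tpath Q R \<sigma> \<Longrightarrow> card (sym_diff Q R) < length \<sigma>"
proof (induction \<sigma> arbitrary: R rule: rev_induct)
  case Nil
  then show ?case by (simp add: tpath_def)
next
  case (snoc S \<sigma>)
  show ?case
  proof (cases "\<sigma> = []")
    case True
    then show ?thesis using snoc.prems by (auto simp: tpath_def)
  next
    case False
    note * = tpath_butlast[OF snoc.prems False]
    have "card (sym_diff Q R) \<le> card (sym_diff Q (last \<sigma>)) + card (sym_diff (last \<sigma>) R)"
      using tpath_ends[OF *(2)] tpath_ends[OF snoc.prems] by (intro card_sym_diff_triangle) auto
    then show ?thesis using * snoc.IH[OF *(2)] by simp
  qed
qed

lemma geod_snoc:
  assumes "geod Q S \<sigma>" "R \<in> topes" "card (sym_diff S R) = 1" "card (sym_diff Q R) = Suc (card (sym_diff Q S))"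
  shows "geod Q R (\<sigma> @ [R])"
  using assms tpath_snoc[of Q S \<sigma> R] unfolding geod_def by (intro conjI) (simp_all only: length_append_singleton)

lemma card_sym_diff_step:
  assumes "Q \<in> topes" "R \<in> topes" "H \<in> sym_diff Q R"
  shows "card (sym_diff Q R) = Suc (card (sym_diff Q (sym_diff R {H})))"
proof -
  have "sym_diff Q (sym_diff R {H}) = sym_diff Q R - {H}" using assms by auto
  then show ?thesis using assms finite_sym_diff_topes by (simp only: card_Suc_Diff1)
qed

section \<open>Faces through a point and the polygon around a codimension-2 face\<close>

lemma sym_diff_cancel: "sym_diff (sym_diff R X) (sym_diff R Y) = sym_diff X Y"
  by blast

text \<open>The region lies on one side of each hyperplane of \<open>M\<close>, so a segment in it
  with an inner point on the hyperplane lies in the hyperplane.\<close>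

lemma face_of_rg:
  assumes "M \<subseteq> \<A>"
  shows "\<Inter>M \<inter> rg R face_of rg R"
  unfolding face_of_def
proof (intro conjI ballI impI)
  have "convex H" if "H \<in> M" for H
    using hyperplane_eq[of H] convex_hyperplane[of "nrm H" "off H"] assms that by auto
  then show "convex (\<Inter>M \<inter> rg R)" by (intro convex_Int convex_Inter convex_rg)
  fix a b x assume ab: "a \<in> rg R" "b \<in> rg R" and x: "x \<in> \<Inter>M \<inter> rg R" "x \<in> open_segment a b"
  then obtain u where u: "0 < u" "u < 1" "x = (1 - u) *\<^sub>R a + u *\<^sub>R b" by (auto simp: in_segment)
  have "lv H a = 0 \<and> lv H b = 0" if "H \<in> M" for H
  proof -
    have H: "H \<in> \<A>" using that assms by auto
    have "lv H x = 0" using x that H mem_hyperplane by blast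
    then have e: "(1 - u) * (sg R H * lv H a) + u * (sg R H * lv H b) = 0"
      unfolding u(3) by (subst (asm) lv_affine) (auto simp: sg_def)
    moreover have "0 \<le> (1 - u) * (sg R H * lv H a)" "0 \<le> u * (sg R H * lv H b)"
      using ab H u by (auto simp: rg_def)
    ultimately have "(1 - u) * (sg R H * lv H a) = 0" "u * (sg R H * lv H b) = 0" by linarith+
    then show ?thesis using u sg_cases[of R H] by auto
  qed
  then show "a \<in> \<Inter>M \<inter> rg R" "b \<in> \<Inter>M \<inter> rg R" using ab assms mem_hyperplane by auto
qed blast

text \<open>Hyperplanes through \<open>z\<close> vanish on the whole face, and the others give
  \<open>T\<close> and \<open>R\<close> the same sign. So the regions around a face can be found by
  testing the single point \<open>z\<close>.\<close>

lemma rg_containing_face: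
  assumes "z \<in> rg R" "M = {H \<in> \<A>. z \<in> H}"
  shows "\<Inter>M \<inter> rg R \<subseteq> rg T \<longleftrightarrow> z \<in> rg T"
proof
  assume "\<Inter>M \<inter> rg R \<subseteq> rg T"
  then show "z \<in> rg T" using assms by auto
next
  assume z: "z \<in> rg T"
  show "\<Inter>M \<inter> rg R \<subseteq> rg T"
    unfolding rg_def
  proof (intro subsetI CollectI ballI)
    fix x H assume x: "x \<in> \<Inter>M \<inter> {x. \<forall>H\<in>\<A>. 0 \<le> sg R H * lv H x}" and H: "H \<in> \<A>"
    show "0 \<le> sg T H * lv H x"
    proof (cases "z \<in> H")
      case True
      then have "lv H x = 0" using assms x H mem_hyperplane[OF H] by blast
      then show ?thesis by simp
    next
      case False
      then have "lv H z \<noteq> 0" using mem_hyperplane[OF H] by blast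
      moreover have "0 \<le> sg T H * lv H z" "0 \<le> sg R H * lv H z" using z assms H by (auto simp: rg_def)
      ultimately have "sg T H = sg R H" using sg_cases[of T H] sg_cases[of R H] by auto
      then show ?thesis using x H by auto
    qed
  qed
qed

text \<open>By \<open>star\<close>, the regions at \<open>z\<close> arise from \<open>R\<close> by
  flipping an initial or a final segment of \<open>hs\<close>. The cycle starts opposite
  \<open>R\<close> with everything flipped, unflips \<open>hs\<close> from the front until it
  reaches \<open>R\<close> at index \<open>length hs\<close>, then flips from the front again. The
  two arcs from the opposite region to \<open>R\<close> are the two sides of the braid move.\<close>

lemma polygon_braid:
  assumes R: "R \<in> topes" and hs: "distinct hs" "2 \<le> length hs" "set hs = {H \<in> \<A>. z \<in> H}"
    and z: "z \<in> rg R" and dim: "aff_dim (\<Inter>(set hs)) = int DIM('a) - 2"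
    and star: "{T \<in> topes. z \<in> rg T} = (\<lambda>i. sym_diff R (set (take i hs))) ` {..length hs} \<union>
       (\<lambda>i. sym_diff R (set (drop i hs))) ` {..length hs}"
  shows "braid_move \<A> (map (\<lambda>i. rg (sym_diff R (set (drop i hs)))) [0..<Suc (length hs)])
     (map (\<lambda>i. rg (sym_diff R (set (take (length hs - i) hs)))) [0..<Suc (length hs)])"
proof -
  let ?k = "length hs"
  define Y where "Y = (\<lambda>j. if j \<le> ?k then set (drop j hs) else set (take (j - ?k) hs))"
  define G where "G j = rg (sym_diff R (Y j))" for j
  define us where "us = map G [1..<?k]"
  define vs where "vs = map (\<lambda>i. rg (sym_diff R (set (take (?k - i) hs)))) [1..<?k]"
  have k: "2 \<le> ?k" by fact
  \<comment> \<open>\<open>vs\<close> runs towards \<open>R\<close>; reversed, it is the second half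
    of the cycle, which leaves \<open>R\<close>.\<close>
  have rv: "rev vs = map G [Suc ?k..<2 * ?k]"
  proof (rule nth_equalityI)
    fix i assume "i < length (rev vs)"
    then have i: "i < ?k - 1" by (simp add: vs_def)
    then show "rev vs ! i = map G [Suc ?k..<2 * ?k] ! i"
      by (simp add: vs_def rev_nth G_def Y_def del: upt_Suc) (simp add: Suc_diff_le)
  qed (simp add: vs_def)
  have cyc: "G 0 # us @ G ?k # rev vs = map G [0..<2 * ?k]"
  proof -
    have "[0..<2 * ?k] = [0..<?k] @ [?k..<2 * ?k]"
      using upt_add_eq_append[of 0 ?k ?k] by (simp add: mult_2)
    moreover have "[0..<?k] = 0 # [Suc 0..<?k]"
      by (rule upt_conv_Cons) (use k in linarith)
    moreover have "[?k..<2 * ?k] = ?k # [Suc ?k..<2 * ?k]"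
      by (rule upt_conv_Cons) (use k in linarith)
    ultimately have "[0..<2 * ?k] = 0 # [1..<?k] @ ?k # [Suc ?k..<2 * ?k]"
      by (simp only: append_Cons One_nat_def)
    then show ?thesis unfolding us_def rv by (simp only: list.map map_append)
  qed
  have tp: "sym_diff R (Y j) \<in> {T \<in> topes. z \<in> rg T}" if "j < 2 * ?k" for j
    unfolding star Y_def using that by auto
  \<comment> \<open>The formula for the second half, taken one index past the end, closes the
    cycle.\<close>
  have Y0: "Y 0 = Y (2 * ?k)" using k by (simp add: Y_def)
  have Yimg: "sym_diff R ` Y ` {..<2 * ?k} = {T \<in> topes. z \<in> rg T}"
  proof
    show "sym_diff R ` Y ` {..<2 * ?k} \<subseteq> {T \<in> topes. z \<in> rg T}" using tp by blast
    have dr: "set (drop i hs) \<in> Y ` {..<2 * ?k}" if "i \<le> ?k" for i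
      using that k by (intro image_eqI[of _ _ i]) (auto simp: Y_def)
    have ta: "set (take i hs) \<in> Y ` {..<2 * ?k}" if "i \<le> ?k" for i
    proof -
      consider "i = 0" | "i = ?k" | "0 < i" "i < ?k" using \<open>i \<le> ?k\<close> by linarith
      then show ?thesis
      proof cases
        case 1 then show ?thesis using k by (intro image_eqI[of _ _ ?k]) (auto simp: Y_def)
      next
        case 2 then show ?thesis using k by (intro image_eqI[of _ _ 0]) (auto simp: Y_def)
      next
        case 3 then show ?thesis using k by (intro image_eqI[of _ _ "?k + i"]) (auto simp: Y_def)
      qed
    qed
    show "{T \<in> topes. z \<in> rg T} \<subseteq> sym_diff R ` Y ` {..<2 * ?k}"
      unfolding star by (intro Un_least image_subsetI imageI dr ta) simp_all
  qed
  have injG: "inj_on G {..<2 * ?k}"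
  proof (rule inj_onI)
    fix i j assume ij: "i \<in> {..<2 * ?k}" "j \<in> {..<2 * ?k}" "G i = G j"
    then have "sym_diff R (Y i) = sym_diff R (Y j)"
      using inj_onD[OF inj_on_rg, of "sym_diff R (Y i)" "sym_diff R (Y j)"] tp by (auto simp: G_def)
    then have "Y i = Y j" by blast
    then show "i = j" using inj_on_polygon[OF hs(1)] ij unfolding Y_def by (auto dest: inj_onD)
  qed
  let ?F = "\<Inter>(set hs) \<inter> rg R"
  have poly: "region_polygon \<A> (map G [0..<2 * ?k])"
    unfolding region_polygon_def
  proof (intro conjI bexI[of _ ?F])
    have "affine H" if "H \<in> set hs" for H
      using hyperplane_eq[of H] affine_hyperplane[of "nrm H" "off H"] hs(3) that by auto
    then have "affine (\<Inter>(set hs))" by (intro affine_Inter)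
    moreover have "0 < sg R K * lv K z" if "K \<in> \<A> - set hs" for K
    proof -
      have "lv K z \<noteq> 0" using that hs(3) mem_hyperplane[of K z] by blast
      moreover have "0 \<le> sg R K * lv K z" using z that by (auto simp: rg_def)
      ultimately show ?thesis using sg_cases[of R K] by auto
    qed
    moreover have "\<Inter>(set hs) \<inter> {x. \<forall>K\<in>\<A> - set hs. 0 < sg R K * lv K x} \<subseteq> ?F"
    proof
      fix x assume x: "x \<in> \<Inter>(set hs) \<inter> {x. \<forall>K\<in>\<A> - set hs. 0 < sg R K * lv K x}"
      have "0 \<le> sg R K * lv K x" if "K \<in> \<A>" for K
      proof (cases "K \<in> set hs")
        case True
        then have "lv K x = 0" using x mem_hyperplane[OF that] by blast
        then show ?thesis by simp
      qed (use x that less_imp_le in auto)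
      then show "x \<in> ?F" using x by (simp add: rg_def)
    qed
    ultimately have "aff_dim ?F = aff_dim (\<Inter>(set hs))"
      using hs(3) by (intro aff_dim_local[of _ z "\<A> - set hs" "sg R"]) auto
    then show "aff_dim ?F = int DIM('a) - 2" using dim by simp
    have "set (map G [0..<2 * ?k]) = rg ` sym_diff R ` Y ` {..<2 * ?k}"
      unfolding set_map image_image set_upt atLeast0LessThan by (rule image_cong) (simp_all only: G_def)
    also have "\<dots> = {R' \<in> regions \<A>. ?F \<subseteq> R'}"
      unfolding Yimg regions_eq using rg_containing_face[OF z hs(3)] by auto
    finally show "set (map G [0..<2 * ?k]) = {R' \<in> regions \<A>. ?F \<subseteq> R'}" .
    have "?F face_of rg R" using hs(3) by (intro face_of_rg) auto
    moreover have "z \<in> ?F" using z hs(3) by auto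
    ultimately show "?F \<in> arrangement_complex \<A>" using R by (auto simp: arrangement_complex_def regions_eq)
    show "distinct (map G [0..<2 * ?k])" using injG by (simp add: distinct_map atLeast0LessThan)
    show "3 \<le> length (map G [0..<2 * ?k])" using k by simp
    show "\<forall>i<length (map G [0..<2 * ?k]). region_adj \<A> (map G [0..<2 * ?k] ! i)
        (map G [0..<2 * ?k] ! (Suc i mod length (map G [0..<2 * ?k])))"
    proof (intro allI impI)
      fix i assume "i < length (map G [0..<2 * ?k])"
      then have i: "i < 2 * ?k" by simp
      have m: "Suc i mod (2 * ?k) < 2 * ?k" by (rule mod_less_divisor) (use k in linarith)
      have e: "Y (Suc i mod (2 * ?k)) = Y (Suc i)"
        using i Y0 by (cases "Suc i = 2 * ?k") auto
      have "card (sym_diff (sym_diff R (Y i)) (sym_diff R (Y (Suc i)))) = 1"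
        unfolding sym_diff_cancel using card_sym_diff_polygon[OF hs(1) i] unfolding Y_def .
      then have "region_adj \<A> (G i) (G (Suc i mod (2 * ?k)))"
        unfolding G_def e using tp[OF i] tp[OF m] e by (subst region_adj_rg) auto
      then show "region_adj \<A> (map G [0..<2 * ?k] ! i)
        (map G [0..<2 * ?k] ! (Suc i mod length (map G [0..<2 * ?k])))"
        using i m by simp
    qed
  qed
  have "[0..<?k] = 0 # [Suc 0..<?k]" by (rule upt_conv_Cons) (use k in linarith)
  then have up: "[0..<Suc ?k] = 0 # [1..<?k] @ [?k]" by simp
  have du: "G 0 # us @ [G ?k] = map (\<lambda>i. rg (sym_diff R (set (drop i hs)))) [0..<Suc ?k]"
    unfolding up us_def by (auto simp: G_def Y_def)
  have tv: "G 0 # vs @ [G ?k] = map (\<lambda>i. rg (sym_diff R (set (take (?k - i) hs)))) [0..<Suc ?k]"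
    unfolding up vs_def by (auto simp: G_def Y_def)
  have "length us = length vs" by (simp add: us_def vs_def)
  then have "braid_move \<A> ([] @ (G 0 # us @ [G ?k]) @ []) ([] @ (G 0 # vs @ [G ?k]) @ [])"
    by (rule braid_move.intros) (use poly cyc in \<open>simp only:\<close>)
  then show ?thesis unfolding du tv append_Nil append_Nil2 .
qed

subsection \<open>Straight segments\<close>

text \<open>The segment from a point \<open>q\<close> to \<open>p\<close> meets \<open>H\<close> where the
  weights of \<open>q\<close> and \<open>p\<close> are in ratio \<open>cr q H p\<close>.\<close>
definition cr :: "'a \<Rightarrow> 'a set \<Rightarrow> 'a \<Rightarrow> real" where
  "cr q H p = - lv H p / lv H q"

text \<open>A projective parameter on the segment: \<open>p\<close> is at 0 and \<open>q\<close> at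
  infinity. In it the crossing with \<open>H\<close> is at \<open>cr q H p\<close>, which for fixed
  \<open>q\<close> is an affine function of \<open>p\<close>.\<close>

definition comb :: "'a \<Rightarrow> real \<Rightarrow> 'a \<Rightarrow> 'a" where
  "comb p \<tau> q = (1 / (1 + \<tau>)) *\<^sub>R p + (\<tau> / (1 + \<tau>)) *\<^sub>R q"

lemma lv_comb: "0 < \<tau> \<Longrightarrow> (1 + \<tau>) * lv H (comb p \<tau> q) = lv H p + \<tau> * lv H q"
proof -
  assume t: "0 < \<tau>"
  then have "1 / (1 + \<tau>) + \<tau> / (1 + \<tau>) = 1" by (simp flip: add_divide_distrib)
  from lv_affine[OF this, of H p q] t show ?thesis by (simp add: comb_def distrib_left)
qed

lemma sg_sym_diff_neg: "H \<in> sym_diff Q R \<Longrightarrow> sg R H = - sg Q H"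
  by (auto simp: sg_def)

lemma sg_sym_diff_same: "H \<notin> sym_diff Q R \<Longrightarrow> sg R H = sg Q H"
  by (auto simp: sg_def)

lemma lv_eq_cr:
  assumes "q \<in> cell Q" "H \<in> \<A>"
  shows "lv H p = - cr q H p * lv H q"
proof -
  have "lv H q \<noteq> 0" using assms by (force simp: cell_def)
  then show ?thesis by (simp add: cr_def)
qed

lemma sg_lv_comb:
  assumes "q \<in> cell Q" "H \<in> \<A>" "0 < \<tau>"
  shows "sg Q H * lv H (comb p \<tau> q) = (\<tau> - cr q H p) / (1 + \<tau>) * (sg Q H * lv H q)"
proof -
  have "(1 + \<tau>) * lv H (comb p \<tau> q) = (\<tau> - cr q H p) * lv H q"
    unfolding lv_comb[OF assms(3)] lv_eq_cr[OF assms(1,2), of p] by (simp add: algebra_simps)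
  then have "lv H (comb p \<tau> q) = (\<tau> - cr q H p) * lv H q / (1 + \<tau>)"
    using assms(3) by (simp add: field_simps)
  then show ?thesis by simp
qed

lemma cr_nonneg:
  assumes "q \<in> cell Q" "p \<in> rg R" "H \<in> sym_diff Q R" "H \<in> \<A>"
  shows "0 \<le> cr q H p"
proof -
  have q: "0 < sg Q H * lv H q" using assms by (auto simp: cell_def)
  have "0 \<le> sg R H * lv H p" using assms by (auto simp: rg_def)
  then have "0 \<le> cr q H p * (sg Q H * lv H q)"
    unfolding sg_sym_diff_neg[OF assms(3)] lv_eq_cr[OF assms(1,4), of p] by (simp add: mult.left_commute)
  then show ?thesis using q by (simp add: zero_le_mult_iff)
qed

lemma sg_lv_comb_same:
  assumes "q \<in> cell Q" "p \<in> rg R" "H \<notin> sym_diff Q R" "H \<in> \<A>" "0 < \<tau>"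
  shows "0 < sg R H * lv H (comb p \<tau> q)"
proof -
  have q: "0 < sg Q H * lv H q" using assms by (auto simp: cell_def)
  have p: "0 \<le> sg R H * lv H p" using assms by (auto simp: rg_def)
  have "sg R H * ((1 + \<tau>) * lv H (comb p \<tau> q)) = sg R H * lv H p + \<tau> * (sg Q H * lv H q)"
    unfolding lv_comb[OF assms(5)] using sg_sym_diff_same[OF assms(3)] by (simp add: algebra_simps)
  also have "\<dots> > 0" using q p assms(5) by (intro add_nonneg_pos mult_pos_pos[of \<tau>])
  finally have "0 < (1 + \<tau>) * (sg R H * lv H (comb p \<tau> q))" by (simp add: mult.left_commute)
  then show ?thesis using assms(5) by (simp add: zero_less_mult_iff)
qed

text \<open>Travelling from \<open>q\<close> to \<open>p\<close> the parameter decreases, so on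
  reaching \<open>\<tau>\<close> exactly the separating hyperplanes of smaller ratio are still
  uncrossed.\<close>

lemma comb_in_cell:
  assumes "q \<in> cell Q" "p \<in> rg R" "0 < \<tau>" "\<And>H. H \<in> \<A> \<Longrightarrow> H \<in> sym_diff Q R \<Longrightarrow> cr q H p \<noteq> \<tau>"
  shows "comb p \<tau> q \<in> cell (sym_diff R {H \<in> sym_diff Q R. cr q H p < \<tau>})"
  unfolding cell_def
proof (intro CollectI ballI)
  fix H assume H: "H \<in> \<A>"
  let ?R' = "sym_diff R {H \<in> sym_diff Q R. cr q H p < \<tau>}"
  have q: "0 < sg Q H * lv H q" using assms H by (auto simp: cell_def)
  show "0 < sg ?R' H * lv H (comb p \<tau> q)"
  proof (cases "H \<in> sym_diff Q R")
    case False
    then have "H \<notin> {H \<in> sym_diff Q R. cr q H p < \<tau>}" by blast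
    then have "sg ?R' H = sg R H" unfolding sg_sym_diff by (simp only: if_False)
    then show ?thesis using sg_lv_comb_same[OF assms(1,2) False H assms(3)] by simp
  next
    case True
    note s = sg_lv_comb[OF assms(1) H assms(3), of p]
    show ?thesis
    proof (cases "cr q H p < \<tau>")
      case lt: True
      then have "H \<in> {H \<in> sym_diff Q R. cr q H p < \<tau>}" using True by blast
      then have "sg ?R' H = sg Q H" unfolding sg_sym_diff using sg_sym_diff_neg[OF True] by (simp only: if_True minus_minus)
      then show ?thesis using s q lt assms(3) by (simp add: zero_less_mult_iff)
    next
      case ge: False
      then have "H \<notin> {H \<in> sym_diff Q R. cr q H p < \<tau>}" by blast
      then have "sg ?R' H = - sg Q H" unfolding sg_sym_diff using sg_sym_diff_neg[OF True] by (simp only: if_False)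
      then have "sg ?R' H * lv H (comb p \<tau> q) = (cr q H p - \<tau>) / (1 + \<tau>) * (sg Q H * lv H q)"
        using s by (simp add: algebra_simps diff_divide_distrib)
      moreover have "\<tau> < cr q H p" using ge assms(4)[OF H True] by linarith
      ultimately show ?thesis using q assms(3) by simp
    qed
  qed
qed

lemma comb_tope:
  assumes "Q \<in> topes" "R \<in> topes" "q \<in> cell Q" "p \<in> rg R" "0 < \<tau>"
    "\<And>H. H \<in> sym_diff Q R \<Longrightarrow> cr q H p \<noteq> \<tau>"
  shows "sym_diff R {H \<in> sym_diff Q R. cr q H p < \<tau>} \<in> topes"
proof -
  have "comb p \<tau> q \<in> cell (sym_diff R {H \<in> sym_diff Q R. cr q H p < \<tau>})"
    using assms by (intro comb_in_cell) auto
  moreover have "sym_diff R {H \<in> sym_diff Q R. cr q H p < \<tau>} \<subseteq> \<A>" using assms by (auto simp: topes_def)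
  ultimately show ?thesis unfolding topes_def by blast
qed

lemma comb_mem_hyperplane:
  assumes "q \<in> cell Q" "H \<in> \<A>" "0 < \<tau>"
  shows "comb p \<tau> q \<in> H \<longleftrightarrow> cr q H p = \<tau>"
proof -
  have q: "0 < sg Q H * lv H q" using assms by (auto simp: cell_def)
  have "comb p \<tau> q \<in> H \<longleftrightarrow> sg Q H * lv H (comb p \<tau> q) = 0"
    unfolding mem_hyperplane[OF assms(2)] by (simp add: sg_def)
  also have "\<dots> \<longleftrightarrow> cr q H p = \<tau>"
    unfolding sg_lv_comb[OF assms] using q assms(3) by auto
  finally show ?thesis .
qed

text \<open>\<open>q\<close> lies on the line through \<open>p\<close> and the point
  \<open>comb p \<tau> q\<close>. Used to contradict the genericity of \<open>q\<close>.\<close>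

lemma comb_affine_hull:
  assumes "0 < \<tau>" "comb p \<tau> q \<in> S" "p \<in> affine hull T" "S \<subseteq> T"
  shows "q \<in> affine hull T"
proof -
  have "q = ((1 + \<tau>) / \<tau>) *\<^sub>R comb p \<tau> q + (- 1 / \<tau>) *\<^sub>R p"
    using assms(1) by (simp add: comb_def scaleR_add_right)
  moreover have "\<dots> \<in> affine hull T"
    using assms hull_inc[of "comb p \<tau> q" T affine]
    by (intro mem_affine[OF affine_affine_hull]) (auto simp: field_simps)
  ultimately show ?thesis by simp
qed

text \<open>Equal ratios make the segment meet \<open>H\<close> and \<open>K\<close> in the same
  point, which is not \<open>p\<close> because the ratio is positive; this puts \<open>q\<close>
  into the excluded hull.\<close>

lemma cr_inj:
  assumes "q \<in> cell Q" "H \<in> \<A>" "K \<in> \<A>" "cr q H p = cr q K p" "0 < cr q H p"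
    "q \<notin> affine hull (insert p (\<Inter>{H, K}))"
  shows "H = K"
proof -
  have "comb p (cr q H p) q \<in> \<Inter>{H, K}"
    using comb_mem_hyperplane[OF assms(1,2,5)] comb_mem_hyperplane[OF assms(1,3,5)] assms(4) by auto
  then have "q \<in> affine hull (insert p (\<Inter>{H, K}))"
    using assms(5) by (elim comb_affine_hull[rotated]) (auto intro: hull_inc)
  then show ?thesis using assms(6) by simp
qed

lemma cr_pos:
  assumes "q \<in> cell Q" "p \<in> rg R" "H \<in> sym_diff Q R" "H \<in> \<A>" "lv H p \<noteq> 0"
  shows "0 < cr q H p"
proof -
  have "cr q H p \<noteq> 0" using lv_eq_cr[OF assms(1,4), of p] assms(5) by auto
  then show ?thesis using cr_nonneg[OF assms(1-4)] by simp
qed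

text \<open>Stop on the segment just before the last crossing: \<open>c\<close> lies between the
  smallest ratio and all others, so only \<open>H\<close> remains to be crossed.\<close>

lemma min_crossing_tope:
  assumes "Q \<in> topes" "R \<in> topes" "q \<in> cell Q" "p \<in> rg R" "H \<in> sym_diff Q R"
    "\<And>K. K \<in> sym_diff Q R \<Longrightarrow> K \<noteq> H \<Longrightarrow> cr q H p < cr q K p"
  shows "sym_diff R {H} \<in> topes"
proof -
  have A: "sym_diff Q R \<subseteq> \<A>" using assms by (auto simp: topes_def)
  obtain c where c: "\<And>x. x \<in> {cr q H p} \<Longrightarrow> x < c"
    "\<And>y. y \<in> (\<lambda>K. cr q K p) ` (sym_diff Q R - {H}) \<Longrightarrow> c < y"
    by (rule finite_separate[of "{cr q H p}" "(\<lambda>K. cr q K p) ` (sym_diff Q R - {H})"])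
      (use assms finite_sym_diff_topes in auto)
  have "0 \<le> cr q H p" using cr_nonneg[OF assms(3,4,5)] A assms(5) by blast
  then have "0 < c" using c(1)[of "cr q H p"] by simp
  moreover have ne: "cr q K p \<noteq> c" if "K \<in> sym_diff Q R" for K
    using c(1)[of "cr q H p"] c(2)[of "cr q K p"] that by (cases "K = H") auto
  ultimately have "sym_diff R {K \<in> sym_diff Q R. cr q K p < c} \<in> topes"
    using assms by (intro comb_tope)
  moreover have "{K \<in> sym_diff Q R. cr q K p < c} = {H}"
    using c(1)[of "cr q H p"] c(2) assms(5) by force
  ultimately show ?thesis by (simp only:)
qed

text \<open>From a generic \<open>q\<close> towards an interior point \<open>p\<close> of
  \<open>R\<close> the hyperplanes are crossed one at a time; the last one crossed is a wall of
  \<open>R\<close>.\<close>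

lemma exists_wall:
  assumes Q: "Q \<in> topes" and R: "R \<in> topes" and ne: "Q \<noteq> R"
  obtains H where "H \<in> sym_diff Q R" "sym_diff R {H} \<in> topes"
proof -
  have A: "sym_diff Q R \<subseteq> \<A>" using assms by (auto simp: topes_def)
  obtain p where p: "p \<in> cell R" using R by (auto simp: topes_def)
  \<comment> \<open>Adding \<open>p\<close> raises the dimension by at most one, so these hulls are
    proper and \<open>q\<close> can avoid them all.\<close>
  let ?B = "(\<lambda>S. insert p (\<Inter>S)) ` {S \<in> Pow \<A>. aff_dim (\<Inter>S) \<le> int DIM('a) - 2}"
  have "aff_dim B < int DIM('a)" if "B \<in> ?B" for B
    using that by (auto simp: aff_dim_insert)
  then obtain q where q: "q \<in> cell Q" "\<And>B. B \<in> ?B \<Longrightarrow> q \<notin> affine hull B"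
    using obtains_generic_point[of ?B "cell Q"] finite_arr open_cell[of Q] Q
    by (auto simp: topes_def)
  have pr: "p \<in> rg R" using p cell_subset_rg by auto
  have inj: "inj_on (\<lambda>H. cr q H p) (sym_diff Q R)"
  proof (rule inj_onI)
    fix H K assume HK: "H \<in> sym_diff Q R" "K \<in> sym_diff Q R" "cr q H p = cr q K p"
    have HA: "H \<in> \<A>" "K \<in> \<A>" using HK(1,2) A by blast+
    show "H = K"
    proof (rule ccontr)
      assume "H \<noteq> K"
      have "aff_dim (\<Inter>{H, K}) \<le> int DIM('a) - 2"
        by (rule aff_dim_Inter_le[of H _ K]) (use HA \<open>H \<noteq> K\<close> in simp_all)
      then have "{H, K} \<in> {S \<in> Pow \<A>. aff_dim (\<Inter>S) \<le> int DIM('a) - 2}"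
        using HA by (intro CollectI conjI) blast+
      then have gen: "q \<notin> affine hull (insert p (\<Inter>{H, K}))" by (intro q(2) imageI)
      have "lv H p \<noteq> 0" using p HA by (force simp: cell_def)
      then have "0 < cr q H p" using cr_pos[OF q(1) pr HK(1)] HA by blast
      then show False using cr_inj[OF q(1) HA HK(3) _ gen] \<open>H \<noteq> K\<close> by blast
    qed
  qed
  have fin: "finite (sym_diff Q R)" "sym_diff Q R \<noteq> {}" using finite_sym_diff_topes Q R ne by auto
  define H where "H = arg_min_on (\<lambda>H. cr q H p) (sym_diff Q R)"
  have H: "H \<in> sym_diff Q R" unfolding H_def by (rule arg_min_if_finite(1)[OF fin])
  have "cr q H p < cr q K p" if "K \<in> sym_diff Q R" "K \<noteq> H" for K
  proof -
    have "cr q H p \<le> cr q K p" unfolding H_def using arg_min_least[OF fin that(1)] .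
    then show ?thesis using inj_onD[OF inj _ H that(1)] that by (metis H inj inj_onD order_le_less)
  qed
  then have "sym_diff R {H} \<in> topes" using min_crossing_tope[OF Q R q(1) pr H] by blast
  then show ?thesis using that H by blast
qed

text \<open>Step back from \<open>R\<close> through a wall that separates it from \<open>Q\<close>,
  and induct on the distance.\<close>

lemma exists_geod:
  assumes "Q \<in> topes" "R \<in> topes"
  shows "\<exists>\<sigma>. geod Q R \<sigma>"
  using assms(2)
proof (induction "card (sym_diff Q R)" arbitrary: R)
  case 0
  then have "sym_diff Q R = {}" using finite_sym_diff_topes[OF assms(1) 0(2)] by simp
  then have "Q = R" by blast
  then show ?case using 0 by (intro exI[of _ "[R]"]) (auto simp: geod_def tpath_def)
next
  case (Suc n)
  then have "Q \<noteq> R" by auto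
  then obtain H where H: "H \<in> sym_diff Q R" "sym_diff R {H} \<in> topes" using exists_wall assms(1) Suc.prems by blast
  note c = card_sym_diff_step[OF assms(1) Suc.prems H(1)]
  obtain \<sigma> where \<sigma>: "geod Q (sym_diff R {H}) \<sigma>" using Suc.hyps(1)[OF _ H(2)] Suc.hyps(2) c by auto
  have "sym_diff (sym_diff R {H}) R = {H}" by blast
  then have "card (sym_diff (sym_diff R {H}) R) = 1" by simp
  then show ?case using geod_snoc[OF \<sigma> Suc.prems _ c] by blast
qed

end

subsection \<open>Sweeping a triangle\<close>

text \<open>In terms of the points \<open>pt s\<close> between \<open>p1\<close> and \<open>p2\<close>, the
  crossing ratio \<open>level H s\<close> is affine in \<open>s\<close>; segments from
  \<open>q\<close> to \<open>pt s\<close> cross the hyperplanes of larger level first.\<close>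
locale sweep = arrangement +
  fixes Q R :: "'a set set" and p1 p2 q :: 'a and H1 H2 :: "'a set"
  assumes Q: "Q \<in> topes" and R: "R \<in> topes" and q: "q \<in> cell Q"
    and p1: "p1 \<in> rg R" and p2: "p2 \<in> rg R"
    and H1: "H1 \<in> sym_diff Q R" and H2: "H2 \<in> sym_diff Q R" and H12: "H1 \<noteq> H2"
    and p1_H1: "\<And>K. K \<in> \<A> \<Longrightarrow> lv K p1 = 0 \<longleftrightarrow> K = H1"
    and p2_H2: "\<And>K. K \<in> \<A> \<Longrightarrow> lv K p2 = 0 \<longleftrightarrow> K = H2"
    and generic1: "\<And>S. S \<subseteq> \<A> \<Longrightarrow> aff_dim (\<Inter>S) \<le> int DIM('a) - 2 \<Longrightarrow>
      q \<notin> affine hull (insert p1 (\<Inter>S))"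
    and generic2: "\<And>S. S \<subseteq> \<A> \<Longrightarrow> aff_dim (\<Inter>S) \<le> int DIM('a) - 3 \<Longrightarrow>
      q \<notin> affine hull (insert p2 (insert p1 (\<Inter>S)))"
begin

definition D :: "'a set set" where "D = sym_diff Q R"

definition pt :: "real \<Rightarrow> 'a" where "pt s = (1 - s) *\<^sub>R p1 + s *\<^sub>R p2"

definition level :: "'a set \<Rightarrow> real \<Rightarrow> real" where "level H s = cr q H (pt s)"

definition slope :: "'a set \<Rightarrow> real" where "slope H = cr q H p2 - cr q H p1"

lemma D_arr: "H \<in> D \<Longrightarrow> H \<in> \<A>"
  using Q R by (auto simp: D_def topes_def)

lemma finite_D: "finite D"
  unfolding D_def using finite_sym_diff_topes Q R by blast

lemma level_eq: "level H s = cr q H p1 + s * slope H"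
  unfolding level_def cr_def pt_def slope_def
  by (subst lv_affine) (simp_all add: diff_divide_distrib add_divide_distrib algebra_simps)

lemma level_shift: "level H (s + d) = level H s + d * slope H"
  by (simp add: level_eq algebra_simps)

lemma pt_rg: "0 \<le> s \<Longrightarrow> s \<le> 1 \<Longrightarrow> pt s \<in> rg R"
  unfolding pt_def using convex_rg[of R] p1 p2 by (intro convexD) auto

lemma cr_p1: "H \<in> D \<Longrightarrow> 0 \<le> cr q H p1" "H \<in> D \<Longrightarrow> cr q H p1 = 0 \<longleftrightarrow> H = H1"
proof -
  assume H: "H \<in> D"
  note HA = D_arr[OF H] and HD = H[unfolded D_def]
  show "0 \<le> cr q H p1" using cr_nonneg[OF q p1 HD HA] .
  show "cr q H p1 = 0 \<longleftrightarrow> H = H1"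
    unfolding p1_H1[OF HA, symmetric] using cr_pos[OF q p1 HD HA] by (force simp: cr_def)
qed

lemma cr_p2: "H \<in> D \<Longrightarrow> 0 \<le> cr q H p2" "H \<in> D \<Longrightarrow> cr q H p2 = 0 \<longleftrightarrow> H = H2"
proof -
  assume H: "H \<in> D"
  note HA = D_arr[OF H] and HD = H[unfolded D_def]
  show "0 \<le> cr q H p2" using cr_nonneg[OF q p2 HD HA] .
  show "cr q H p2 = 0 \<longleftrightarrow> H = H2"
    unfolding p2_H2[OF HA, symmetric] using cr_pos[OF q p2 HD HA] by (force simp: cr_def)
qed

text \<open>The end values are nonnegative, and since \<open>H1\<close> and \<open>H2\<close> differ
  no hyperplane has value 0 at both ends.\<close>

lemma level_pos:
  assumes "H \<in> D" "0 < s" "s < 1"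
  shows "0 < level H s"
proof -
  have e: "level H s = (1 - s) * cr q H p1 + s * cr q H p2"
    by (simp add: level_eq slope_def algebra_simps)
  have nn: "0 \<le> (1 - s) * cr q H p1" "0 \<le> s * cr q H p2"
    using cr_p1(1)[OF assms(1)] cr_p2(1)[OF assms(1)] assms(2,3) by simp_all
  consider "0 < cr q H p1" | "0 < cr q H p2"
    using cr_p1[OF assms(1)] cr_p2[OF assms(1)] H12 by (metis order_le_less)
  then show ?thesis
  proof cases
    case 1
    then have "0 < (1 - s) * cr q H p1" using assms by simp
    then show ?thesis using e nn by linarith
  next
    case 2
    then have "0 < s * cr q H p2" using assms by simp
    then show ?thesis using e nn by linarith
  qed
qed

text \<open>The value 0 belongs to \<open>H1\<close> alone; for positive values
  \<open>generic1\<close> keeps the segment from \<open>q\<close> to \<open>p1\<close> off all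
  codimension-2 flats. Hence distinct hyperplanes give distinct lines, as
  \<open>level_slope_inj\<close> states.\<close>

lemma cr_p1_inj:
  assumes "H \<in> D" "K \<in> D" "cr q H p1 = cr q K p1"
  shows "H = K"
proof (rule ccontr)
  assume ne: "H \<noteq> K"
  then have "cr q H p1 \<noteq> 0" using cr_p1(2) assms by metis
  then have pos: "0 < cr q H p1" using cr_p1(1)[OF assms(1)] by simp
  have "aff_dim (\<Inter>{H, K}) \<le> int DIM('a) - 2"
    by (rule aff_dim_Inter_le[of H _ K]) (use assms D_arr ne in simp_all)
  then have "q \<notin> affine hull (insert p1 (\<Inter>{H, K}))"
    by (intro generic1) (use assms D_arr in simp_all)
  then show False using cr_inj[OF q D_arr D_arr assms(3) pos] assms ne by blast
qed

lemma level_slope_inj: "H \<in> D \<Longrightarrow> K \<in> D \<Longrightarrow> level H s = level K s \<Longrightarrow> slope H = slope K \<Longrightarrow> H = K"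
  by (rule cr_p1_inj) (simp_all add: level_eq)

text \<open>The lower envelope at \<open>s\<close> belongs to \<open>H\<close> alone, so
  \<open>H\<close> is the last hyperplane crossed on the way from \<open>q\<close> to
  \<open>pt s\<close>.\<close>

definition unique_min :: "'a set \<Rightarrow> real \<Rightarrow> bool" where
  "unique_min H s \<longleftrightarrow> H \<in> D \<and> 0 \<le> s \<and> s \<le> 1 \<and> (\<forall>K\<in>D. K \<noteq> H \<longrightarrow> level H s < level K s)"

lemma unique_min_tope: "unique_min H s \<Longrightarrow> sym_diff R {H} \<in> topes"
  unfolding unique_min_def level_def D_def using pt_rg Q R q by (intro min_crossing_tope[of Q R q "pt s"]) auto

lemma unique_min_H1: "unique_min H1 0"
proof -
  have "cr q H1 p1 < cr q H p1" if "H \<in> D" "H \<noteq> H1" for H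
    using cr_p1[OF that(1)] cr_p1(2)[of H1] H1 that unfolding D_def by (metis order_le_less)
  then show ?thesis using H1 unfolding unique_min_def level_eq D_def by simp
qed

lemma unique_min_H2: "unique_min H2 1"
proof -
  have "cr q H2 p2 < cr q H p2" if "H \<in> D" "H \<noteq> H2" for H
    using cr_p2[OF that(1)] cr_p2(2)[of H2] H2 that unfolding D_def by (metis order_le_less)
  then show ?thesis using H2 unfolding unique_min_def level_eq slope_def D_def by simp
qed

end

section \<open>A vertex of the lower envelope and the codimension-2 face belonging to it\<close>

locale crossing = sweep +
  fixes s \<tau> :: real and K K' :: "'a set"
  assumes s: "0 < s" "s < 1"
    and min: "\<And>H. H \<in> D \<Longrightarrow> \<tau> \<le> level H s"
    and K: "K \<in> D" "level K s = \<tau>" and K': "K' \<in> D" "level K' s = \<tau>" and KK': "K \<noteq> K'"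
begin

definition M :: "'a set set" where "M = {H \<in> D. level H s = \<tau>}"

text \<open>The point of the triangle whose projective coordinates are those of the vertex,
  \<open>(s, \<tau>)\<close>.\<close>

definition z :: 'a where "z = comb (pt s) \<tau> q"

lemma tau_pos: "0 < \<tau>" using level_pos[OF K(1) s] K(2) by simp

lemma M_D: "H \<in> M \<Longrightarrow> H \<in> D" by (simp add: M_def)

lemma slope_inj: "H \<in> M \<Longrightarrow> H' \<in> M \<Longrightarrow> slope H = slope H' \<Longrightarrow> H = H'"
  using level_slope_inj[of H H' s] by (simp add: M_def)

text \<open>A separating hyperplane outside \<open>M\<close> has level above \<open>\<tau>\<close>,
  so it is crossed before \<open>z\<close> is reached; a hyperplane outside \<open>D\<close> is not
  crossed at all.\<close>

lemma z_pos:
  assumes "H \<in> \<A>" "H \<notin> M" shows "0 < sg R H * lv H z"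
proof (cases "H \<in> D")
  case False
  then show ?thesis unfolding z_def D_def
    using sg_lv_comb_same[OF q pt_rg _ assms(1) tau_pos] s by simp
next
  case True
  then have lt: "\<tau> < level H s" using min[OF True] assms(2) by (simp add: M_def)
  have "0 < sg Q H * lv H q" using q assms(1) by (auto simp: cell_def)
  then have "0 < (level H s - \<tau>) / (1 + \<tau>) * (sg Q H * lv H q)"
    using lt tau_pos by simp
  also have "\<dots> = sg R H * lv H z"
    using sg_lv_comb[OF q assms(1) tau_pos, of "pt s"] sg_sym_diff_neg[OF True[unfolded D_def]]
    unfolding z_def level_def by (simp add: algebra_simps diff_divide_distrib)
  finally show ?thesis .
qed

lemma z_mem: "{H \<in> \<A>. z \<in> H} = M"
proof -
  have "z \<in> H \<longleftrightarrow> H \<in> M" if H: "H \<in> \<A>" for H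
  proof (cases "H \<in> D")
    case True
    then show ?thesis unfolding z_def M_def level_def
      using comb_mem_hyperplane[OF q H tau_pos] by simp
  next
    case False
    then have "H \<notin> M" using M_D by blast
    then show ?thesis using z_pos[OF H] mem_hyperplane[OF H, of z] by auto
  qed
  then show ?thesis using M_D D_arr by blast
qed

lemma z_rg_sym_diff:
  assumes "N \<subseteq> M" shows "z \<in> rg (sym_diff R N)"
  unfolding rg_def
proof (intro CollectI ballI)
  fix H assume H: "H \<in> \<A>"
  show "0 \<le> sg (sym_diff R N) H * lv H z"
  proof (cases "H \<in> M")
    case True
    then have "lv H z = 0" using z_mem mem_hyperplane[OF H] by blast
    then show ?thesis by simp
  next
    case False
    then have "H \<notin> N" using assms by blast
    then have "sg (sym_diff R N) H = sg R H" unfolding sg_sym_diff by (simp only: if_False)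
    then show ?thesis using z_pos[OF H False] by simp
  qed
qed

text \<open>Two distinct hyperplanes give the upper bound. If the flat were smaller, its hull with
  \<open>p1\<close> and \<open>p2\<close> would contain \<open>z\<close> and \<open>pt s\<close>,
  hence \<open>q\<close>, against \<open>generic2\<close>.\<close>

lemma aff_dim_M: "aff_dim (\<Inter>M) = int DIM('a) - 2"
proof (rule antisym)
  have M: "K \<in> M" "K' \<in> M" "M \<subseteq> \<A>" using K K' D_arr by (auto simp: M_def)
  show "aff_dim (\<Inter>M) \<le> int DIM('a) - 2" by (rule aff_dim_Inter_le[OF M(1,2) KK' M(3)])
  show "int DIM('a) - 2 \<le> aff_dim (\<Inter>M)"
  proof (rule ccontr)
    assume "\<not> ?thesis"
    then have "q \<notin> affine hull (insert p2 (insert p1 (\<Inter>M)))" using M by (intro generic2) auto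
    moreover have "q \<in> affine hull (insert p2 (insert p1 (\<Inter>M)))"
    proof (rule comb_affine_hull[OF tau_pos])
      show "comb (pt s) \<tau> q \<in> \<Inter>M" using z_mem unfolding z_def by blast
      show "pt s \<in> affine hull (insert p2 (insert p1 (\<Inter>M)))"
        unfolding pt_def by (intro mem_affine[OF affine_affine_hull] hull_inc) auto
    qed blast
    ultimately show False by blast
  qed
qed

text \<open>Nested nonempty flats of equal dimension coincide. So vanishing on \<open>K\<close> and
  \<open>K'\<close> implies vanishing on all of \<open>M\<close>.\<close>

lemma Inter_M: "K \<inter> K' = \<Inter>M"
proof -
  have M: "K \<in> M" "K' \<in> M" "M \<subseteq> \<A>" using K K' D_arr by (auto simp: M_def)
  have aff: "affine H" if "H \<in> M" for H
    using hyperplane_eq[of H] affine_hyperplane[of "nrm H" "off H"] M that by auto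
  have "aff_dim (\<Inter>{K, K'}) \<le> int DIM('a) - 2"
    by (rule aff_dim_Inter_le[of K _ K']) (use M KK' in auto)
  moreover have sub: "\<Inter>M \<subseteq> K \<inter> K'" using M by blast
  ultimately have "aff_dim (\<Inter>M) = aff_dim (K \<inter> K')"
    using aff_dim_M aff_dim_subset[OF sub] by simp
  moreover have "z \<in> \<Inter>M" using z_mem by blast
  ultimately show ?thesis
    using sub aff M by (intro affine_dim_equal[symmetric] affine_Inter affine_Int) blast+
qed

text \<open>Since the hyperplanes in \<open>M\<close> share a flat of codimension 2, any sign pattern on
  \<open>M\<close> is that of a direction in the plane of the triangle.\<close>
lemma tope_at_z:
  assumes T: "T \<in> topes" and zT: "z \<in> rg T"
  shows "\<exists>\<alpha> \<beta>. T = sym_diff R {H \<in> M. \<alpha> + \<beta> * slope H < 0}"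
proof -
  obtain y where y: "y \<in> cell T" using T by (auto simp: topes_def)
  \<comment> \<open>\<open>\<alpha>\<close> and \<open>\<beta>\<close> solve the two linear
    equations that make the ratio of \<open>y\<close> equal to \<alpha> + \<beta> *
    \<open>slope\<close> on \<open>K\<close> and \<open>K'\<close>.\<close>
  define \<beta> where "\<beta> = (cr q K y - cr q K' y) / (slope K - slope K')"
  define \<alpha> where "\<alpha> = cr q K y - \<beta> * slope K"
  \<comment> \<open>For \<open>H\<close> in \<open>M\<close>, adding \<open>pt s - q\<close> raises
    the ratio by \<open>1 + \<tau>\<close> and adding \<open>p2 - p1\<close> raises it by
    \<open>slope H\<close>, so \<open>y'\<close> has ratio 0 on \<open>K\<close> and
    \<open>K'\<close>.\<close>
  define y' where "y' = y - (\<alpha> / (1 + \<tau>)) *\<^sub>R (pt s - q) - \<beta> *\<^sub>R (p2 - p1)"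
  have M: "K \<in> M" "K' \<in> M" using K K' by (auto simp: M_def)
  have "slope K \<noteq> slope K'" using slope_inj[OF M] KK' by blast
  then have "\<beta> * (slope K - slope K') = cr q K y - cr q K' y" by (simp add: \<beta>_def)
  then have ab: "cr q K y = \<alpha> + \<beta> * slope K" "cr q K' y = \<alpha> + \<beta> * slope K'"
    by (simp_all add: \<alpha>_def algebra_simps)
  have cry': "cr q H y' = cr q H y - (\<alpha> + \<beta> * slope H)" if H: "H \<in> M" for H
  proof -
    have nz: "lv H q \<noteq> 0" using q D_arr[OF M_D[OF H]] by (force simp: cell_def)
    have "cr q H (pt s) = \<tau>" using H by (simp add: M_def level_def)
    then have pts: "lv H (pt s) = - \<tau> * lv H q"
      using lv_eq_cr[OF q D_arr[OF M_D[OF H]], of "pt s"] by (simp only:)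
    have "lv H y' = lv H y - (\<alpha> / (1 + \<tau>)) * (nrm H \<bullet> (pt s - q)) - \<beta> * (nrm H \<bullet> (p2 - p1))"
      by (simp add: y'_def lv_def inner_diff_right)
    moreover have "nrm H \<bullet> (pt s - q) = - (1 + \<tau>) * lv H q"
      using pts by (simp add: lv_def inner_diff_right algebra_simps)
    moreover have "(\<alpha> / (1 + \<tau>)) * (- (1 + \<tau>) * lv H q) = - \<alpha> * lv H q"
    proof -
      have "a / n * (- n * b) = - a * b" if "n \<noteq> 0" for a b n :: real using that by simp
      from this[of "1 + \<tau>"] show ?thesis using tau_pos by simp
    qed
    moreover have "nrm H \<bullet> (p2 - p1) = lv H p2 - lv H p1"
      by (simp add: lv_def inner_diff_right)
    ultimately have "lv H y' = lv H y + \<alpha> * lv H q - \<beta> * (lv H p2 - lv H p1)" by simp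
    then show ?thesis
      using nz by (simp add: cr_def slope_def add_divide_distrib diff_divide_distrib right_diff_distrib)
  qed
  have "y' \<in> H" if "H \<in> {K, K'}" for H
  proof -
    have HM: "H \<in> M" and crH: "cr q H y = \<alpha> + \<beta> * slope H" using that M ab by blast+
    have "cr q H y' = 0" "H \<in> \<A>" using cry'[OF HM] crH D_arr[OF M_D[OF HM]] by simp_all
    then show ?thesis using lv_eq_cr[OF q, of H y'] mem_hyperplane[of H y'] by simp
  qed
  \<comment> \<open>The pencil property carries the formula for the ratio of \<open>y\<close> over
    to every hyperplane of \<open>M\<close>.\<close>
  then have y'M: "y' \<in> \<Inter>M" using Inter_M by blast
  have cry: "cr q H y = \<alpha> + \<beta> * slope H" if "H \<in> M" for H
  proof -
    have "lv H y' = 0" using y'M that mem_hyperplane[OF D_arr[OF M_D[OF that]]] by blast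
    then show ?thesis using cry'[OF that] by (simp add: cr_def)
  qed
  let ?N = "{H \<in> M. \<alpha> + \<beta> * slope H < 0}"
  have "y \<in> cell (sym_diff R ?N)"
    unfolding cell_def
  proof (intro CollectI ballI)
    fix H assume H: "H \<in> \<A>"
    have yT: "0 < sg T H * lv H y" using y H by (auto simp: cell_def)
    show "0 < sg (sym_diff R ?N) H * lv H y"
    proof (cases "H \<in> M")
      case False
      have "0 \<le> sg T H * lv H z" using zT H by (auto simp: rg_def)
      then have "sg T H = sg R H"
        using z_pos[OF H False] sg_cases[of T H] sg_cases[of R H] by auto
      moreover have "H \<notin> ?N" using False by blast
      then have "sg (sym_diff R ?N) H = sg R H" unfolding sg_sym_diff by (simp only: if_False)
      ultimately show ?thesis using yT by simp
    next
      case True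
      have neg: "sg R H = - sg Q H" using sg_sym_diff_neg M_D[OF True] unfolding D_def by blast
      have qH: "0 < sg Q H * lv H q" using q H by (auto simp: cell_def)
      have lvy: "lv H y = - (\<alpha> + \<beta> * slope H) * lv H q" using lv_eq_cr[OF q H, of y] cry[OF True] by simp
      have nz: "\<alpha> + \<beta> * slope H \<noteq> 0"
      proof
        assume "\<alpha> + \<beta> * slope H = 0"
        then have "lv H y = 0" unfolding lvy by (simp only: minus_zero mult_zero_left)
        then show False using yT by simp
      qed
      show ?thesis
      proof (cases "\<alpha> + \<beta> * slope H < 0")
        case lt: True
        then have "H \<in> ?N" using True by blast
        then have "sg (sym_diff R ?N) H = sg Q H" unfolding sg_sym_diff neg by (simp only: if_True minus_minus)
        then have "sg (sym_diff R ?N) H * lv H y = - (\<alpha> + \<beta> * slope H) * (sg Q H * lv H q)"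
          unfolding lvy by (simp add: algebra_simps)
        moreover have "0 < - (\<alpha> + \<beta> * slope H) * (sg Q H * lv H q)"
          by (rule mult_pos_pos) (use lt qH in linarith)+
        ultimately show ?thesis by (simp only:)
      next
        case ge: False
        then have "H \<notin> ?N" by blast
        then have "sg (sym_diff R ?N) H = - sg Q H" unfolding sg_sym_diff neg by (simp only: if_False)
        then have "sg (sym_diff R ?N) H * lv H y = (\<alpha> + \<beta> * slope H) * (sg Q H * lv H q)"
          unfolding lvy by (simp add: algebra_simps)
        moreover have "0 < (\<alpha> + \<beta> * slope H) * (sg Q H * lv H q)"
          by (rule mult_pos_pos) (use ge nz qH in linarith)+
        ultimately show ?thesis by (simp only:)
      qed
    qed
  qed
  moreover have "T \<subseteq> \<A>" "R \<subseteq> \<A>" "?N \<subseteq> \<A>" using T R M_D D_arr by (auto simp: topes_def)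
  ultimately have "T = sym_diff R ?N"
    using y cell_subset_rg by (intro mem_cell_unique[of T "sym_diff R ?N" y]) blast+
  then show ?thesis by blast
qed

text \<open>Move from the vertex a little along a line of slope \<open>c\<close>. The levels outside
  \<open>M\<close> stay above by continuity; which lines of \<open>M\<close> are below depends on
  their slope and on the direction of the move.\<close>

lemma nearby_tope:
  assumes c: "\<And>H. H \<in> M \<Longrightarrow> slope H \<noteq> c"
  shows "sym_diff R {H \<in> M. slope H < c} \<in> topes" "sym_diff R {H \<in> M. c < slope H} \<in> topes"
proof -
  have "\<forall>\<^sub>F d in nhds (0::real). 0 < s + d \<and> s + d < 1 \<and> 0 < \<tau> + d * c \<and>
      (\<forall>H\<in>D - M. \<tau> + d * c < level H (s + d))"
  proof (intro eventually_conj eventually_ball_finite ballI)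
    have lim: "((\<lambda>d. a + d * b) \<longlongrightarrow> a + 0 * b) (nhds (0::real))" for a b :: real
      by (intro tendsto_intros filterlim_ident)
    show "\<forall>\<^sub>F d in nhds 0. 0 < s + d" using order_tendstoD(1)[OF lim[of s 1], of 0] s by simp
    show "\<forall>\<^sub>F d in nhds 0. s + d < 1" using order_tendstoD(2)[OF lim[of s 1], of 1] s by simp
    show "\<forall>\<^sub>F d in nhds 0. 0 < \<tau> + d * c" using order_tendstoD(1)[OF lim[of \<tau> c], of 0] tau_pos by simp
    show "finite (D - M)" using finite_D by simp
    fix H assume H: "H \<in> D - M"
    then have "\<tau> < level H s" using min[of H] by (auto simp: M_def order_le_less)
    then have "\<forall>\<^sub>F d in nhds 0. 0 < (level H s - \<tau>) + d * (slope H - c)"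
      using order_tendstoD(1)[OF lim[of "level H s - \<tau>" "slope H - c"], of 0] by simp
    then show "\<forall>\<^sub>F d in nhds 0. \<tau> + d * c < level H (s + d)"
    proof (rule eventually_mono)
      fix d assume "0 < (level H s - \<tau>) + d * (slope H - c)"
      then have "0 < level H s - \<tau> + (d * slope H - d * c)" by (simp only: right_diff_distrib)
      then show "\<tau> + d * c < level H (s + d)" unfolding level_shift by linarith
    qed
  qed
  then obtain e where e: "0 < e" "\<And>d. dist d 0 < e \<Longrightarrow> 0 < s + d \<and> s + d < 1 \<and> 0 < \<tau> + d * c \<and>
      (\<forall>H\<in>D - M. \<tau> + d * c < level H (s + d))"
    unfolding eventually_nhds_metric by blast
  have key: "sym_diff R {H \<in> M. d * slope H < d * c} \<in> topes" if d: "d \<noteq> 0" "dist d 0 < e" for d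
  proof -
    note ed = e(2)[OF d(2)]
    have levM: "level H (s + d) = \<tau> + d * slope H" if "H \<in> M" for H
      using that by (simp add: level_shift M_def)
    have "sym_diff R {H \<in> sym_diff Q R. cr q H (pt (s + d)) < \<tau> + d * c} \<in> topes"
    proof (rule comb_tope[OF Q R q])
      show "pt (s + d) \<in> rg R" using ed by (intro pt_rg) auto
      show "0 < \<tau> + d * c" using ed by simp
      fix H assume "H \<in> sym_diff Q R"
      then have H: "H \<in> D" by (simp only: D_def)
      show "cr q H (pt (s + d)) \<noteq> \<tau> + d * c"
      proof (cases "H \<in> M")
        case True
        then show ?thesis using levM[OF True] c[OF True] d unfolding level_def by simp
      next
        case False
        then have "\<tau> + d * c < level H (s + d)" using ed H by blast
        then show ?thesis unfolding level_def by simp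
      qed
    qed
    moreover have "{H \<in> sym_diff Q R. cr q H (pt (s + d)) < \<tau> + d * c} = {H \<in> M. d * slope H < d * c}"
    proof -
      have "level H (s + d) < \<tau> + d * c \<longleftrightarrow> H \<in> M \<and> d * slope H < d * c" if "H \<in> D" for H
        using levM[of H] ed that by (cases "H \<in> M") force+
      then show ?thesis unfolding D_def[symmetric] level_def[symmetric] using M_D by blast
    qed
    ultimately show ?thesis by (simp only:)
  qed
  \<comment> \<open>A move to the right sees the smaller slopes below it, a move to the left the
    larger ones.\<close>
  have "{H \<in> M. e / 2 * slope H < e / 2 * c} = {H \<in> M. slope H < c}" using e(1) by auto
  moreover have "{H \<in> M. - (e / 2) * slope H < - (e / 2) * c} = {H \<in> M. c < slope H}" using e(1) by auto
  ultimately show "sym_diff R {H \<in> M. slope H < c} \<in> topes" "sym_diff R {H \<in> M. c < slope H} \<in> topes"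
    using key[of "e / 2"] key[of "- (e / 2)"] e(1) by (simp_all only:) simp_all
qed

text \<open>By \<open>tope_at_z\<close> a tope at \<open>z\<close> flips the lines on which an
  affine function of the slope is negative: an initial or a final segment, according to the sign of
  \<open>\<beta>\<close>. Conversely, \<open>nearby_tope\<close> with \<open>c\<close> in the gap at
  position \<open>i\<close> realises both segments.\<close>

lemma star_eq:
  assumes hs: "set hs = M" "sorted_wrt (\<lambda>x y. slope x < slope y) hs"
  shows "{T \<in> topes. z \<in> rg T} = (\<lambda>i. sym_diff R (set (take i hs))) ` {..length hs} \<union>
       (\<lambda>i. sym_diff R (set (drop i hs))) ` {..length hs}"
proof
  show "{T \<in> topes. z \<in> rg T} \<subseteq> (\<lambda>i. sym_diff R (set (take i hs))) ` {..length hs} \<union>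
       (\<lambda>i. sym_diff R (set (drop i hs))) ` {..length hs}"
  proof
    fix T assume "T \<in> {T \<in> topes. z \<in> rg T}"
    then obtain \<alpha> \<beta> where T: "T = sym_diff R {H \<in> M. \<alpha> + \<beta> * slope H < 0}" using tope_at_z by blast
    show "T \<in> (\<lambda>i. sym_diff R (set (take i hs))) ` {..length hs} \<union>
       (\<lambda>i. sym_diff R (set (drop i hs))) ` {..length hs}"
    proof (cases "0 \<le> \<beta>")
      case True
      have "sorted_wrt (\<lambda>x y. \<alpha> + \<beta> * slope y < 0 \<longrightarrow> \<alpha> + \<beta> * slope x < 0) hs"
      proof (rule sorted_wrt_mono_rel[OF _ hs(2)])
        fix x y assume "slope x < slope y"
        then have "\<beta> * slope x \<le> \<beta> * slope y" using True by (simp add: mult_left_mono)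
        then show "\<alpha> + \<beta> * slope y < 0 \<longrightarrow> \<alpha> + \<beta> * slope x < 0" by linarith
      qed
      then obtain i where "i \<le> length hs" "{H \<in> set hs. \<alpha> + \<beta> * slope H < 0} = set (take i hs)"
        using sorted_wrt_split_take_drop[of "\<lambda>x. \<alpha> + \<beta> * slope x < 0" hs] by blast
      then show ?thesis unfolding T hs(1)[symmetric] by (intro UnI1 image_eqI[of _ _ i]) (simp_all only: atMost_iff)
    next
      case False
      have "sorted_wrt (\<lambda>x y. \<not> \<alpha> + \<beta> * slope y < 0 \<longrightarrow> \<not> \<alpha> + \<beta> * slope x < 0) hs"
      proof (rule sorted_wrt_mono_rel[OF _ hs(2)])
        fix x y assume "slope x < slope y"
        then have "\<beta> * slope y \<le> \<beta> * slope x" using False by (simp add: mult_left_mono_neg)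
        then show "\<not> \<alpha> + \<beta> * slope y < 0 \<longrightarrow> \<not> \<alpha> + \<beta> * slope x < 0" by linarith
      qed
      then obtain i where "i \<le> length hs" "{H \<in> set hs. \<not> \<not> \<alpha> + \<beta> * slope H < 0} = set (drop i hs)"
        using sorted_wrt_split_take_drop[of "\<lambda>x. \<not> \<alpha> + \<beta> * slope x < 0" hs] by blast
      then show ?thesis unfolding T hs(1)[symmetric] not_not by (intro UnI2 image_eqI[of _ _ i]) (simp_all only: atMost_iff)
    qed
  qed
  have "sym_diff R (set (take i hs)) \<in> topes \<and> sym_diff R (set (drop i hs)) \<in> topes" for i
  proof -
    have ap: "sorted_wrt (\<lambda>x y. slope x < slope y) (take i hs @ drop i hs)" using hs(2) by simp
    obtain c where c: "\<And>x. x \<in> slope ` set (take i hs) \<Longrightarrow> x < c" "\<And>y. y \<in> slope ` set (drop i hs) \<Longrightarrow> c < y"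
      by (rule finite_separate[of "slope ` set (take i hs)" "slope ` set (drop i hs)"])
        (use ap in \<open>auto simp only: sorted_wrt_append finite_imageI finite_set\<close>)
    have un: "M = set (take i hs) \<union> set (drop i hs)" using hs(1) by (metis append_take_drop_id set_append)
    have ne: "slope H \<noteq> c" if "H \<in> M" for H
      using c(1)[of "slope H"] c(2)[of "slope H"] that unfolding un by auto
    have "{H \<in> M. slope H < c} = set (take i hs)" "{H \<in> M. c < slope H} = set (drop i hs)"
      using c unfolding un by fastforce+
    then show ?thesis using nearby_tope[OF ne] by simp
  qed
  moreover have "z \<in> rg (sym_diff R (set (take i hs)))" "z \<in> rg (sym_diff R (set (drop i hs)))" for i
    using z_rg_sym_diff hs(1) set_take_subset[of i hs] set_drop_subset[of i hs] by blast+
  ultimately show "(\<lambda>i. sym_diff R (set (take i hs))) ` {..length hs} \<union>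
       (\<lambda>i. sym_diff R (set (drop i hs))) ` {..length hs} \<subseteq> {T \<in> topes. z \<in> rg T}"
    by (intro Un_least image_subsetI CollectI conjI) blast+
qed

end

subsection \<open>Connecting reduced paths\<close>

context arrangement
begin

definition conn :: "'a set set \<Rightarrow> 'a set set \<Rightarrow> bool" where
  "conn Q R \<longleftrightarrow> (\<forall>\<sigma> \<tau>. geod Q R \<sigma> \<longrightarrow> geod Q R \<tau> \<longrightarrow> moves (map rg \<sigma>) (map rg \<tau>))"

text \<open>Directed, since \<open>moves\<close> includes nil moves; both directions are therefore
  carried through the envelope argument.\<close>

definition last_equiv :: "'a set set \<Rightarrow> 'a set set \<Rightarrow> 'a set \<Rightarrow> 'a set \<Rightarrow> bool" where
  "last_equiv Q R H H' \<longleftrightarrow> (\<forall>\<sigma> \<tau>. geod Q (sym_diff R {H}) \<sigma> \<longrightarrow> geod Q (sym_diff R {H'}) \<tau> \<longrightarrow>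
     moves (map rg (\<sigma> @ [R])) (map rg (\<tau> @ [R])))"

lemma last_equiv_refl: "conn Q (sym_diff R {H}) \<Longrightarrow> last_equiv Q R H H"
  unfolding conn_def last_equiv_def using moves_snoc by blast

text \<open>The universally quantified relations need a reduced path to the middle region to be
  chained.\<close>

lemma last_equiv_trans:
  assumes "Q \<in> topes" "sym_diff R {H'} \<in> topes" "last_equiv Q R H H'" "last_equiv Q R H' H''"
  shows "last_equiv Q R H H''"
proof -
  obtain \<pi> where "geod Q (sym_diff R {H'}) \<pi>" using exists_geod[OF assms(1,2)] by blast
  then show ?thesis using assms(3,4) unfolding last_equiv_def by (meson rtranclp_trans)
qed

text \<open>Every hyperplane of \<open>hs\<close> separates \<open>Q\<close> from \<open>R\<close>,
  so each unflipping moves one step further from \<open>Q\<close> and the path stays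
  reduced.\<close>

lemma geod_drops:
  assumes Q: "Q \<in> topes" and hs: "distinct hs" "set hs \<subseteq> sym_diff Q R"
    and T: "\<And>i. sym_diff R (set (drop i hs)) \<in> topes"
    and \<pi>: "geod Q (sym_diff R (set hs)) \<pi>" and m: "m \<le> length hs"
  shows "geod Q (sym_diff R (set (drop m hs))) (\<pi> @ map (\<lambda>i. sym_diff R (set (drop i hs))) [1..<Suc m])"
  using m
proof (induction m)
  case 0
  then show ?case using \<pi> by simp
next
  case (Suc m)
  let ?S = "sym_diff R (set (drop m hs))" and ?T = "sym_diff R (set (drop (Suc m) hs))"
  have m: "m < length hs" using Suc.prems by simp
  have d: "drop m hs = hs ! m # drop (Suc m) hs" using m by (simp add: Cons_nth_drop_Suc)
  then have sd: "set (drop m hs) = insert (hs ! m) (set (drop (Suc m) hs))" by simp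
  have nin: "hs ! m \<notin> set (drop (Suc m) hs)" using hs(1) d distinct_drop[of hs m] by simp
  have "hs ! m \<in> sym_diff Q R" using hs(2) m nth_mem by blast
  then have h: "hs ! m \<in> sym_diff Q ?T" using nin by blast
  have ST: "?S = sym_diff ?T {hs ! m}" unfolding sd using nin by blast
  have c: "card (sym_diff Q ?T) = Suc (card (sym_diff Q ?S))"
    unfolding ST by (rule card_sym_diff_step[OF Q T h])
  have "sym_diff ?S ?T = {hs ! m}" unfolding sd using nin by blast
  then have c1: "card (sym_diff ?S ?T) = 1" by (simp only: card_1_singleton_iff) simp
  have "geod Q ?S (\<pi> @ map (\<lambda>i. sym_diff R (set (drop i hs))) [1..<Suc m])" using Suc by simp
  from geod_snoc[OF this T c1 c] show ?case by simp
qed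

text \<open>One reduced path to the region opposite \<open>R\<close> is continued to
  \<open>R\<close> along both arcs of the polygon, which one braid move relates. The two
  \<open>conn\<close> hypotheses replace arbitrary reduced paths to the neighbours of
  \<open>R\<close> by these.\<close>

lemma polygon_last_equiv:
  assumes Q: "Q \<in> topes" and hs: "distinct hs" "2 \<le> length hs" "set hs \<subseteq> sym_diff Q R"
    and D: "\<And>i. sym_diff R (set (drop i hs)) \<in> topes" and T: "\<And>i. sym_diff R (set (take i hs)) \<in> topes"
    and braid: "braid_move \<A> (map (\<lambda>i. rg (sym_diff R (set (drop i hs)))) [0..<Suc (length hs)])
     (map (\<lambda>i. rg (sym_diff R (set (take (length hs - i) hs)))) [0..<Suc (length hs)])"
    and cl: "conn Q (sym_diff R {last hs})" and ch: "conn Q (sym_diff R {hd hs})"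
  shows "last_equiv Q R (last hs) (hd hs)"
proof -
  let ?k = "length hs"
  let ?d = "\<lambda>i. sym_diff R (set (drop i hs))" and ?t = "\<lambda>i. sym_diff R (set (take (?k - i) hs))"
  have R': "sym_diff R (set hs) \<in> topes" using D[of 0] by simp
  then obtain \<pi> where \<pi>: "geod Q (sym_diff R (set hs)) \<pi>" using exists_geod[OF Q] by blast
  have ne: "hs \<noteq> []" using hs(2) by auto
  have dr: "set (drop i (rev hs)) = set (take (?k - i) hs)" for i by (simp add: drop_rev)
  have "Suc (?k - 1) = ?k" using hs(2) by linarith
  then have up: "[1..<Suc (?k - 1)] = [1..<?k]" by (simp only:)
  have "drop (?k - 1) hs = [last hs]"
    using ne by (metis append_butlast_last_id append_eq_conv_conj length_butlast)
  then have "set (drop (?k - 1) hs) = {last hs}" by simp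
  then have g1: "geod Q (sym_diff R {last hs}) (\<pi> @ map ?d [1..<?k])"
    using geod_drops[OF Q hs(1,3) D \<pi>, of "?k - 1"] unfolding up by simp
  have "take 1 hs = [hd hs]" using ne by (cases hs) auto
  moreover have "?k - (?k - 1) = 1" using hs(2) by simp
  ultimately have "set (take (?k - (?k - 1)) hs) = {hd hs}" by simp
  then have g2: "geod Q (sym_diff R {hd hs}) (\<pi> @ map ?t [1..<?k])"
    using geod_drops[of Q "rev hs" R \<pi> "?k - 1"] hs Q T \<pi> unfolding up dr by simp
  \<comment> \<open>The last region of \<open>\<pi>\<close> is already the first one of both arcs,
    so it is split off.\<close>
  have \<pi>eq: "\<pi> = butlast \<pi> @ [sym_diff R (set hs)]"
    using \<pi> unfolding geod_def tpath_def by (metis append_butlast_last_id)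
  have "[0..<?k] = 0 # [Suc 0..<?k]" by (rule upt_conv_Cons) (use hs(2) in linarith)
  then have upt: "[0..<Suc ?k] = 0 # [1..<?k] @ [?k]" by simp
  have e1: "map rg ((\<pi> @ map ?d [1..<?k]) @ [R]) = map rg (butlast \<pi>) @ map (\<lambda>i. rg (?d i)) [0..<Suc ?k]"
    unfolding upt by (subst \<pi>eq) simp
  have e2: "map rg ((\<pi> @ map ?t [1..<?k]) @ [R]) = map rg (butlast \<pi>) @ map (\<lambda>i. rg (?t i)) [0..<Suc ?k]"
    unfolding upt by (subst \<pi>eq) simp
  have "braid_move \<A> (map rg ((\<pi> @ map ?d [1..<?k]) @ [R])) (map rg ((\<pi> @ map ?t [1..<?k]) @ [R]))"
    unfolding e1 e2 using braid_move_append[OF braid, of "map rg (butlast \<pi>)" "[]"]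
    by (simp only: append_Nil2)
  then have mid: "moves (map rg ((\<pi> @ map ?d [1..<?k]) @ [R])) (map rg ((\<pi> @ map ?t [1..<?k]) @ [R]))"
    by blast
  show ?thesis
    unfolding last_equiv_def
  proof (intro allI impI)
    fix \<sigma> \<tau> assume st: "geod Q (sym_diff R {last hs}) \<sigma>" "geod Q (sym_diff R {hd hs}) \<tau>"
    have "moves (map rg (\<sigma> @ [R])) (map rg ((\<pi> @ map ?d [1..<?k]) @ [R]))"
      using cl st(1) g1 unfolding conn_def by (intro moves_snoc) blast
    moreover have "moves (map rg ((\<pi> @ map ?t [1..<?k]) @ [R])) (map rg (\<tau> @ [R]))"
      using ch st(2) g2 unfolding conn_def by (intro moves_snoc) blast
    ultimately show "moves (map rg (\<sigma> @ [R])) (map rg (\<tau> @ [R]))"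
      using mid by (meson rtranclp_trans)
  qed
qed

end

text \<open>With \<open>M\<close> sorted by slope, \<open>K'\<close> comes first and
  \<open>K\<close> last: they are the two walls of \<open>R\<close> in the polygon around
  \<open>z\<close>. Reversing the list gives the other direction.\<close>

lemma (in crossing) crossing_last_equiv:
  assumes conn: "\<And>H. H \<in> D \<Longrightarrow> sym_diff R {H} \<in> topes \<Longrightarrow> conn Q (sym_diff R {H})"
    and mx: "\<And>H. H \<in> M \<Longrightarrow> slope H \<le> slope K" and mn: "\<And>H. H \<in> M \<Longrightarrow> slope K' \<le> slope H"
  shows "last_equiv Q R K K' \<and> last_equiv Q R K' K"
proof -
  have fM: "finite M" using finite_D by (simp add: M_def)
  then obtain xs where xs: "set xs = M" "distinct xs" using finite_distinct_list by blast
  define hs where "hs = sort_key slope xs"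
  have hs: "set hs = M" "distinct hs" "sorted (map slope hs)" using xs by (simp_all add: hs_def)
  have "inj_on slope (set hs)" using slope_inj unfolding hs(1) by (rule inj_onI)
  then have "sorted_wrt (<) (map slope hs)" using hs by (simp add: strict_sorted_iff distinct_map)
  then have srt: "sorted_wrt (\<lambda>x y. slope x < slope y) hs" by (simp add: sorted_wrt_map)
  have KM: "K \<in> M" "K' \<in> M" using K K' by (auto simp: M_def)
  then have ne: "hs \<noteq> []" using hs(1) by auto
  have len: "2 \<le> length hs"
  proof -
    have "card {K, K'} \<le> card M" by (rule card_mono) (use fM KM in auto)
    then show ?thesis using KK' hs distinct_card[of hs] by simp
  qed
  have last: "last hs = K"
  proof (rule ccontr)
    assume ne': "last hs \<noteq> K"
    have e: "hs = butlast hs @ [last hs]" using ne by simp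
    then have "K \<in> set (butlast hs)" using KM hs(1) ne' by (metis UnE empty_iff empty_set set_append set_ConsD list.set(1) list.simps(15) insert_iff)
    moreover have "sorted_wrt (\<lambda>x y. slope x < slope y) (butlast hs @ [last hs])" using srt e by metis
    ultimately have "slope K < slope (last hs)" by (simp add: sorted_wrt_append)
    moreover have "last hs \<in> M" using hs(1) ne last_in_set by blast
    ultimately show False using mx by force
  qed
  have hd: "hd hs = K'"
  proof (rule ccontr)
    assume ne': "hd hs \<noteq> K'"
    have e: "hs = hd hs # tl hs" using ne by simp
    then have "K' \<in> set (tl hs)" using KM hs(1) ne' by (metis set_ConsD)
    moreover have "sorted_wrt (\<lambda>x y. slope x < slope y) (hd hs # tl hs)" using srt e by metis
    ultimately have "slope (hd hs) < slope K'" by simp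
    moreover have "hd hs \<in> M" using hs(1) ne hd_in_set by blast
    ultimately show False using mn by force
  qed
  note star = star_eq[OF hs(1) srt]
  have R_z: "z \<in> rg R" using z_rg_sym_diff[of "{}"] by simp
  \<comment> \<open>Indices beyond the length give the same segments as the length itself.\<close>
  have tp: "sym_diff R (set (drop i hs)) \<in> topes" "sym_diff R (set (take i hs)) \<in> topes" for i
  proof -
    have "sym_diff R (set (drop (min i (length hs)) hs)) \<in> {T \<in> topes. z \<in> rg T}"
      "sym_diff R (set (take (min i (length hs)) hs)) \<in> {T \<in> topes. z \<in> rg T}"
      unfolding star by (intro UnI2 imageI, simp) (intro UnI1 imageI, simp)
    then show "sym_diff R (set (drop i hs)) \<in> topes" "sym_diff R (set (take i hs)) \<in> topes"
      by (cases "i \<le> length hs"; simp)+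
  qed
  have sz: "set hs = {H \<in> \<A>. z \<in> H}" using hs(1) z_mem by simp
  have dim: "aff_dim (\<Inter>(set hs)) = int DIM('a) - 2" using aff_dim_M hs(1) by simp
  have dr: "set (drop i (rev hs)) = set (take (length hs - i) hs)"
    "set (take i (rev hs)) = set (drop (length hs - i) hs)" for i
    by (simp_all add: drop_rev take_rev)
  have im: "(\<lambda>i. f (length hs - i)) ` {..length hs} = f ` {..length hs}" for f :: "nat \<Rightarrow> 'a set set"
  proof -
    have "x \<in> (\<lambda>i. length hs - i) ` {..length hs}" if "x \<le> length hs" for x
      using that by (intro image_eqI[of _ _ "length hs - x"]) auto
    then have "(\<lambda>i. length hs - i) ` {..length hs} = {..length hs}" by auto
    then show ?thesis by (metis image_image)
  qed
  have star': "{T \<in> topes. z \<in> rg T} = (\<lambda>i. sym_diff R (set (take i (rev hs)))) ` {..length (rev hs)} \<union>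
       (\<lambda>i. sym_diff R (set (drop i (rev hs)))) ` {..length (rev hs)}"
    unfolding star dr length_rev im[of "\<lambda>i. sym_diff R (set (take i hs))"] im[of "\<lambda>i. sym_diff R (set (drop i hs))"]
    by (rule Un_commute)
  have sub: "set hs \<subseteq> sym_diff Q R" using hs(1) M_D unfolding D_def by blast
  have "drop (length hs - 1) hs = [last hs]"
    using ne by (metis append_butlast_last_id append_eq_conv_conj length_butlast)
  then have tK: "sym_diff R {K} \<in> topes" using tp(1)[of "length hs - 1"] last by simp
  have "take 1 hs = [hd hs]" using ne by (cases hs) auto
  then have tK': "sym_diff R {K'} \<in> topes" using tp(2)[of 1] hd by simp
  have cK: "conn Q (sym_diff R {K})" "conn Q (sym_diff R {K'})" using conn K K' tK tK' by blast+
  have "last_equiv Q R (last hs) (hd hs)"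
    by (rule polygon_last_equiv[OF Q hs(2) len sub tp polygon_braid[OF R hs(2) len sz R_z dim star]])
      (use cK last hd in simp_all)
  moreover have "last_equiv Q R (last (rev hs)) (hd (rev hs))"
  proof (rule polygon_last_equiv[OF Q])
    show "braid_move \<A> (map (\<lambda>i. rg (sym_diff R (set (drop i (rev hs))))) [0..<Suc (length (rev hs))])
     (map (\<lambda>i. rg (sym_diff R (set (take (length (rev hs) - i) (rev hs))))) [0..<Suc (length (rev hs))])"
      by (rule polygon_braid[OF R _ _ _ R_z _ star']) (use hs len sz dim in simp_all)
    show "sym_diff R (set (drop i (rev hs))) \<in> topes" "sym_diff R (set (take i (rev hs))) \<in> topes" for i
      unfolding dr by (rule tp)+
  qed (use hs len sub cK last hd ne in \<open>simp_all add: last_rev hd_rev\<close>)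
  ultimately show ?thesis unfolding last_rev hd_rev last hd by blast
qed

text \<open>The lower envelope is concave, so a line that is lower than \<open>H\<close> and
  \<open>H'\<close> at their crossing point has a slope strictly between theirs: induction on the number
  of such slopes.\<close>
lemma (in sweep) envelope_last_equiv:
  assumes conn: "\<And>H. H \<in> D \<Longrightarrow> sym_diff R {H} \<in> topes \<Longrightarrow> conn Q (sym_diff R {H})"
  shows "unique_min H s0 \<Longrightarrow> unique_min H' s1 \<Longrightarrow> s0 < s1 \<Longrightarrow> H \<noteq> H' \<Longrightarrow>
    last_equiv Q R H H' \<and> last_equiv Q R H' H"
proof (induction "card {h \<in> D. slope H' < slope h \<and> slope h < slope H}" arbitrary: H H' s0 s1 rule: less_induct)
  case less
  note unique_min = less.prems(1,2) and lt = less.prems(3) and ne = less.prems(4)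
  have HD: "H \<in> D" "H' \<in> D" and s01: "0 \<le> s0" "s1 \<le> 1" using unique_min by (auto simp: unique_min_def)
  have l0: "level H s0 < level h s0" if "h \<in> D" "h \<noteq> H" for h using unique_min(1)[unfolded unique_min_def] that by blast
  have l1: "level H' s1 < level h s1" if "h \<in> D" "h \<noteq> H'" for h using unique_min(2)[unfolded unique_min_def] that by blast
  \<comment> \<open>A line that overtakes another has the larger slope; equality is allowed at one
    end, since lines may meet there.\<close>
  have slope_less: "slope a < slope b" if "level b u \<le> level a u" "level a v \<le> level b v"
    "level b u < level a u \<or> level a v < level b v" "u < v" for a b u v
  proof -
    have "(v - u) * slope a < (v - u) * slope b"
      using that by (simp add: level_eq algebra_simps) linarith
    then show ?thesis using that(4) by simp
  qed
  have d0: "level H s0 < level H' s0" and d1: "level H' s1 < level H s1" using l0 l1 HD ne by blast+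
  have slope_HH': "slope H' < slope H" by (rule slope_less[of _ s0 _ s1]) (use d0 d1 lt in auto)
  \<comment> \<open>The abscissa at which the lines of \<open>H\<close> and \<open>H'\<close>
    meet.\<close>
  define s where "s = (cr q H' p1 - cr q H p1) / (slope H - slope H')"
  have "s * (slope H - slope H') = cr q H' p1 - cr q H p1" using slope_HH' by (simp add: s_def)
  then have eq: "level H s = level H' s" by (simp add: level_eq algebra_simps)
  have gap: "level H u - level H' u = (u - s) * (slope H - slope H')" for u
    using eq by (simp add: level_eq algebra_simps)
  have s0s: "s0 < s" using gap[of s0] d0 slope_HH' by (smt (verit) mult_nonneg_nonneg)
  have ss1: "s < s1" using gap[of s1] d1 slope_HH' by (smt (verit) mult_nonneg_nonneg mult_minus_left)
  show ?case
  proof (cases "\<forall>h\<in>D. level H s \<le> level h s")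
    case True
    interpret crossing \<A> nrm off Q R p1 p2 q H1 H2 s "level H s" H H'
      by unfold_locales (use True HD eq ne s0s ss1 s01 in auto)
    \<comment> \<open>Among the lines through the vertex, \<open>H\<close> is lowest on the left at
      \<open>s0\<close>, hence steepest; symmetrically \<open>H'\<close> has the least
      slope.\<close>
    have "slope h \<le> slope H" if "h \<in> M" for h
    proof (cases "h = H")
      case False
      then have "level H s0 < level h s0" using l0 M_D[OF that] by blast
      moreover have "level h s = level H s" using that by (simp add: M_def)
      ultimately show ?thesis using slope_less[of H s0 h s] s0s by simp
    qed simp
    moreover have "slope H' \<le> slope h" if "h \<in> M" for h
    proof (cases "h = H'")
      case False
      then have "level H' s1 < level h s1" using l1 M_D[OF that] by blast
      moreover have "level h s = level H s" using that by (simp add: M_def)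
      ultimately show ?thesis using slope_less[of h s H' s1] ss1 eq by simp
    qed simp
    ultimately show ?thesis using crossing_last_equiv conn by blast
  next
    case False
    then obtain k where k: "k \<in> D" "level k s < level H s" by force
    \<comment> \<open>Near the crossing point \<open>k\<close> stays below both lines;
      \<open>u\<close> is then chosen there so that all levels at \<open>u\<close> are
      distinct.\<close>
    have "\<forall>\<^sub>F u in nhds s. s0 < u \<and> u < s1 \<and> level k u < level H u \<and> level k u < level H' u"
    proof (intro eventually_conj)
      have lim: "(level h \<longlongrightarrow> level h s) (nhds s)" for h
        unfolding level_eq by (intro tendsto_intros filterlim_ident)
      have pos: "\<forall>\<^sub>F u in nhds s. level k u < level h u" if "level k s < level h s" for h
        using order_tendstoD(1)[OF tendsto_diff[OF lim[of h] lim[of k]], of 0] that by simp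
      show "\<forall>\<^sub>F u in nhds s. level k u < level H u" "\<forall>\<^sub>F u in nhds s. level k u < level H' u"
        using pos k eq by simp_all
      show "\<forall>\<^sub>F u in nhds s. s0 < u" "\<forall>\<^sub>F u in nhds s. u < s1"
        using order_tendstoD[OF filterlim_ident[of "nhds s"]] s0s ss1 by simp_all
    qed
    then obtain e where e: "0 < e" "\<And>u. dist u s < e \<Longrightarrow> s0 < u \<and> u < s1 \<and> level k u < level H u \<and> level k u < level H' u"
      unfolding eventually_nhds_metric by blast
    \<comment> \<open>The abscissae at which two different lines meet; there is at most one for each
      pair.\<close>
    let ?F = "\<Union>a\<in>D. \<Union>b\<in>D. if a = b then {} else {u. level a u = level b u}"
    have "finite (if a = b then {} else {u. level a u = level b u})" if "a \<in> D" "b \<in> D" for a b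
    proof (cases "a = b")
      case False
      have "u = v" if uv: "level a u = level b u" "level a v = level b v" for u v
      proof (rule ccontr)
        assume "u \<noteq> v"
        have "(u - v) * (slope a - slope b) = 0" using uv by (simp add: level_eq algebra_simps)
        then have "slope a = slope b" using \<open>u \<noteq> v\<close> by simp
        then show False using level_slope_inj[OF \<open>a \<in> D\<close> \<open>b \<in> D\<close> uv(1)] False by blast
      qed
      then have "{u. level a u = level b u} \<subseteq> {SOME u. level a u = level b u}" by (metis (mono_tags, lifting) mem_Collect_eq singletonI someI subsetI)
      then show ?thesis using finite_subset by auto
    qed simp
    then have fin: "finite ?F" using finite_D by (intro finite_UN_I) blast+
    have "infinite {s..<s + e}" using e(1) by (simp add: infinite_Ico)
    then obtain u where u: "u \<in> {s..<s + e}" "u \<notin> ?F" using fin by (meson finite_subset subsetI)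
    then have ue: "s0 < u" "u < s1" "level k u < level H u" "level k u < level H' u"
      using e(2)[of u] by (auto simp: dist_real_def)
    have Dne: "D \<noteq> {}" using HD by blast
    \<comment> \<open>The lowest line at \<open>u\<close> need not be \<open>k\<close>, but it too
      is below \<open>H\<close> and \<open>H'\<close>. Both remaining pairs have fewer intermediate
      slopes, because \<open>h\<close> itself no longer counts.\<close>
    define h where "h = arg_min_on (\<lambda>h. level h u) D"
    have h: "h \<in> D" unfolding h_def by (rule arg_min_if_finite(1)[OF finite_D Dne])
    have hmin: "level h u \<le> level a u" if "a \<in> D" for a
      unfolding h_def using arg_min_least[OF finite_D Dne that] .
    have hlt: "level h u < level a u" if a: "a \<in> D" "a \<noteq> h" for a
    proof -
      have "level h u \<noteq> level a u"
      proof
        assume "level h u = level a u"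
        then have "u \<in> (if h = a then {} else {u. level h u = level a u})" unfolding if_not_P[OF a(2)[symmetric]] by (rule CollectI)
        then show False using u(2) h a(1) by blast
      qed
      then show ?thesis using hmin[OF a(1)] by simp
    qed
    have uh: "unique_min h u" unfolding unique_min_def using h hlt ue s01 by simp
    have hH: "level h u < level H u" "level h u < level H' u" using hmin[OF k(1)] ue by linarith+
    then have nH: "h \<noteq> H" "h \<noteq> H'" by auto
    have s1': "slope h < slope H" using slope_less[of H s0 h u] l0[OF h nH(1)] hH ue by simp
    have s2': "slope H' < slope h" using slope_less[of h u H' s1] l1[OF h nH(2)] hH ue by simp
    have "last_equiv Q R H h \<and> last_equiv Q R h H"
    proof (rule less.hyps[OF _ unique_min(1) uh ue(1)])
      show "card {x \<in> D. slope h < slope x \<and> slope x < slope H} < card {x \<in> D. slope H' < slope x \<and> slope x < slope H}"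
        by (rule psubset_card_mono) (use finite_D h s1' s2' in auto)
    qed (use nH in blast)
    moreover have "last_equiv Q R h H' \<and> last_equiv Q R H' h"
    proof (rule less.hyps[OF _ uh unique_min(2) ue(2)])
      show "card {x \<in> D. slope H' < slope x \<and> slope x < slope h} < card {x \<in> D. slope H' < slope x \<and> slope x < slope H}"
        by (rule psubset_card_mono) (use finite_D h s1' s2' in auto)
    qed (use nH in blast)
    ultimately show ?thesis using last_equiv_trans[OF Q unique_min_tope[OF uh]] by blast
  qed
qed

section \<open>From two last walls to arbitrary paths\<close>

context arrangement
begin

lemma walls_last_equiv:
  assumes Q: "Q \<in> topes" and R: "R \<in> topes"
    and H1: "H1 \<in> sym_diff Q R" "sym_diff R {H1} \<in> topes" and H2: "H2 \<in> sym_diff Q R" "sym_diff R {H2} \<in> topes"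
    and conn: "\<And>H. H \<in> sym_diff Q R \<Longrightarrow> sym_diff R {H} \<in> topes \<Longrightarrow> conn Q (sym_diff R {H})"
  shows "last_equiv Q R H1 H2"
proof (cases "H1 = H2")
  case True
  then show ?thesis using last_equiv_refl conn H1 by blast
next
  case False
  have HA: "H1 \<in> \<A>" "H2 \<in> \<A>" using Q R H1 H2 by (auto simp: topes_def)
  have wall: "\<exists>p\<in>rg R. \<forall>K\<in>\<A>. lv K p = 0 \<longleftrightarrow> K = H" if HA: "H \<in> \<A>" and HT: "sym_diff R {H} \<in> topes" for H
  proof -
    obtain p where p: "lv H p = 0" "\<And>K. K \<in> \<A> \<Longrightarrow> K \<noteq> H \<Longrightarrow> 0 < sg R K * lv K p"
      using wall_point[OF R HT HA] by blast
    have "0 \<le> sg R K * lv K p \<and> (lv K p = 0 \<longleftrightarrow> K = H)" if "K \<in> \<A>" for K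
      using p(1) p(2)[OF that] by (cases "K = H") (simp, force)
    then show ?thesis by (intro bexI[of _ p]) (auto simp only: rg_def mem_Collect_eq)
  qed
  obtain p1 where p1: "p1 \<in> rg R" "\<And>K. K \<in> \<A> \<Longrightarrow> lv K p1 = 0 \<longleftrightarrow> K = H1"
    using wall[OF HA(1) H1(2)] by blast
  obtain p2 where p2: "p2 \<in> rg R" "\<And>K. K \<in> \<A> \<Longrightarrow> lv K p2 = 0 \<longleftrightarrow> K = H2"
    using wall[OF HA(2) H2(2)] by blast
  \<comment> \<open>One added point for codimension 2 and two for codimension 3 leave dimension at
    most n - 1, so one \<open>q\<close> can avoid all these hulls.\<close>
  let ?B1 = "(\<lambda>S. insert p1 (\<Inter>S)) ` {S \<in> Pow \<A>. aff_dim (\<Inter>S) \<le> int DIM('a) - 2}"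
  let ?B2 = "(\<lambda>S. insert p2 (insert p1 (\<Inter>S))) ` {S \<in> Pow \<A>. aff_dim (\<Inter>S) \<le> int DIM('a) - 3}"
  have ins: "aff_dim (insert p S) \<le> aff_dim S + 1" for p :: 'a and S by (simp add: aff_dim_insert)
  have B1: "aff_dim B < int DIM('a)" if B: "B \<in> ?B1" for B
  proof -
    obtain S where S: "aff_dim (\<Inter>S) \<le> int DIM('a) - 2" "B = insert p1 (\<Inter>S)" using B by blast
    then show ?thesis unfolding S(2) using ins[of p1 "\<Inter>S"] S(1) by linarith
  qed
  have B2: "aff_dim B < int DIM('a)" if B: "B \<in> ?B2" for B
  proof -
    obtain S where S: "aff_dim (\<Inter>S) \<le> int DIM('a) - 3" "B = insert p2 (insert p1 (\<Inter>S))" using B by blast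
    then show ?thesis unfolding S(2) using ins[of p2 "insert p1 (\<Inter>S)"] ins[of p1 "\<Inter>S"] S(1) by linarith
  qed
  have fin: "finite (?B1 \<union> ?B2)" using finite_arr by simp
  have ne: "cell Q \<noteq> {}" using Q by (simp add: topes_def)
  have dim: "aff_dim B < int DIM('a)" if "B \<in> ?B1 \<union> ?B2" for B
    using that B1[of B] B2[of B] by (elim UnE)
  obtain q where q: "q \<in> cell Q" "\<And>B. B \<in> ?B1 \<union> ?B2 \<Longrightarrow> q \<notin> affine hull B"
    by (rule obtains_generic_point[OF fin open_cell ne dim], assumption, rule that, assumption, blast)
  interpret sweep \<A> nrm off Q R p1 p2 q H1 H2
  proof unfold_locales
    show "q \<notin> affine hull (insert p1 (\<Inter>S))" if "S \<subseteq> \<A>" "aff_dim (\<Inter>S) \<le> int DIM('a) - 2" for S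
      by (rule q(2), rule UnI1, rule imageI) (use that in blast)
    show "q \<notin> affine hull (insert p2 (insert p1 (\<Inter>S)))" if "S \<subseteq> \<A>" "aff_dim (\<Inter>S) \<le> int DIM('a) - 3" for S
      by (rule q(2), rule UnI2, rule imageI) (use that in blast)
  qed (fact Q R q(1) p1 p2 H1(1) H2(1) False)+
  show ?thesis using envelope_last_equiv[OF _ unique_min_H1 unique_min_H2] conn False unfolding D_def by simp
qed

lemma conn_topes:
  assumes Q: "Q \<in> topes" and R: "R \<in> topes"
  shows "conn Q R"
  using R
proof (induction "card (sym_diff Q R)" arbitrary: R rule: less_induct)
  case less
  note R = less.prems
  have IH: "conn Q (sym_diff R {H})" if "H \<in> sym_diff Q R" "sym_diff R {H} \<in> topes" for H
    by (rule less.hyps[OF _ that(2)]) (use card_sym_diff_step[OF Q R that(1)] in simp)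
  \<comment> \<open>The last step of a reduced path must cross a hyperplane separating
    \<open>Q\<close> from \<open>R\<close>: otherwise the region before \<open>R\<close> would be
    further from \<open>Q\<close> than the remaining path is long.\<close>
  have split: "\<exists>H \<sigma>'. \<sigma> = \<sigma>' @ [R] \<and> H \<in> sym_diff Q R \<and> sym_diff R {H} \<in> topes \<and> geod Q (sym_diff R {H}) \<sigma>'"
    if g: "geod Q R \<sigma>" and ne: "Q \<noteq> R" for \<sigma>
  proof -
    have t: "tpath Q R \<sigma>" and len: "length \<sigma> = Suc (card (sym_diff Q R))" using g by (auto simp: geod_def)
    have "sym_diff Q R \<noteq> {}" using ne by blast
    then have "card (sym_diff Q R) \<noteq> 0" using finite_sym_diff_topes[OF Q R] by (simp only: card_0_eq) simp
    then have "2 \<le> length \<sigma>" using len by linarith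
    then have "\<sigma> = butlast \<sigma> @ [last \<sigma>]" "butlast \<sigma> \<noteq> []"
      by (cases \<sigma> rule: rev_cases; auto)+
    then obtain \<sigma>' S where \<sigma>: "\<sigma> = \<sigma>' @ [S]" "\<sigma>' \<noteq> []" by blast
    note b = tpath_butlast[OF t[unfolded \<sigma>(1)] \<sigma>(2)]
    obtain H where H: "sym_diff (last \<sigma>') R = {H}" using b(3) by (elim card_1_singletonE)
    then have l: "last \<sigma>' = sym_diff R {H}" by blast
    have lt: "card (sym_diff Q (sym_diff R {H})) < card (sym_diff Q R)"
      using tpath_length[OF b(2)] len \<sigma> unfolding l by simp
    have HQ: "H \<in> sym_diff Q R"
    proof (rule ccontr)
      assume n: "H \<notin> sym_diff Q R"
      then have "H \<in> sym_diff Q (sym_diff R {H})" by blast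
      then have "card (sym_diff Q (sym_diff R {H})) = Suc (card (sym_diff Q (sym_diff (sym_diff R {H}) {H})))"
        using card_sym_diff_step[OF Q] b(4) unfolding l by blast
      moreover have "sym_diff (sym_diff R {H}) {H} = R" by blast
      ultimately show False using lt by simp
    qed
    have "geod Q (sym_diff R {H}) \<sigma>'"
      using b(2) card_sym_diff_step[OF Q R HQ] len \<sigma> unfolding l geod_def by simp
    then show ?thesis using \<sigma> b(1) HQ b(4) unfolding l by blast
  qed
  show ?case
    unfolding conn_def
  proof (intro allI impI)
    fix \<sigma> \<tau> assume g: "geod Q R \<sigma>" "geod Q R \<tau>"
    show "moves (map rg \<sigma>) (map rg \<tau>)"
    proof (cases "Q = R")
      case True
      have "\<rho> = [R]" if "geod Q R \<rho>" for \<rho>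
        using that True by (cases \<rho>) (auto simp: geod_def tpath_def)
      from this[OF g(1)] this[OF g(2)] show ?thesis by simp
    next
      case False
      obtain H \<sigma>' where s: "\<sigma> = \<sigma>' @ [R]" "H \<in> sym_diff Q R" "sym_diff R {H} \<in> topes" "geod Q (sym_diff R {H}) \<sigma>'"
        using split[OF g(1) False] by blast
      obtain K \<tau>' where t: "\<tau> = \<tau>' @ [R]" "K \<in> sym_diff Q R" "sym_diff R {K} \<in> topes" "geod Q (sym_diff R {K}) \<tau>'"
        using split[OF g(2) False] by blast
      have "last_equiv Q R H K" using walls_last_equiv[OF Q R s(2,3) t(2,3) IH] .
      then show ?thesis using s t unfolding last_equiv_def by blast
    qed
  qed
qed

text \<open>Induction on the last step, from \<open>S\<close> to \<open>R\<close>. The claim is made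
  for every reduced path \<open>\<rho>\<close> so that the induction hypothesis can be aimed at a
  convenient path to \<open>S\<close>.\<close>

lemma tpath_moves:
  "tpath Q R \<gamma> \<Longrightarrow> geod Q R \<rho> \<Longrightarrow> moves (map rg \<gamma>) (map rg \<rho>)"
proof (induction \<gamma> arbitrary: R \<rho> rule: rev_induct)
  case Nil
  then show ?case by (simp add: tpath_def)
next
  case (snoc R' \<gamma>)
  show ?case
  proof (cases "\<gamma> = []")
    case True
    then have "Q = R" "R' = R" using snoc.prems(1) by (auto simp: tpath_def)
    then have "\<rho> = [R]" using snoc.prems(2) by (cases \<rho>) (auto simp: geod_def tpath_def)
    then show ?thesis using True \<open>R' = R\<close> by simp
  next
    case False
    define S where "S = last \<gamma>"
    note b = tpath_butlast[OF snoc.prems(1) False, folded S_def]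
    have QR: "Q \<in> topes" "R \<in> topes" using tpath_ends[OF snoc.prems(1)] by auto
    obtain H where H: "sym_diff S R = {H}" using b(3) by (elim card_1_singletonE)
    then have SR: "S = sym_diff R {H}" "R = sym_diff S {H}" by blast+
    have c': "card (sym_diff R S) = 1" using b(3) by (simp only: Un_commute)
    consider "H \<in> sym_diff Q R" | "H \<in> sym_diff Q S" using SR by blast
    then show ?thesis
    proof cases
      case 1
      have c: "card (sym_diff Q R) = Suc (card (sym_diff Q S))"
        unfolding SR(1) by (rule card_sym_diff_step[OF QR 1])
      obtain \<pi> where \<pi>: "geod Q S \<pi>" using exists_geod[OF QR(1) b(4)] by blast
      have "moves (map rg (\<gamma> @ [R])) (map rg (\<pi> @ [R]))" using snoc.IH[OF b(2) \<pi>] by (rule moves_snoc)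
      moreover have "moves (map rg (\<pi> @ [R])) (map rg \<rho>)"
        using conn_topes[OF QR] geod_snoc[OF \<pi> QR(2) b(3) c] snoc.prems(2) unfolding conn_def by blast
      ultimately show ?thesis unfolding b(1) by (rule rtranclp_trans)
    next
      case 2
      have c: "card (sym_diff Q S) = Suc (card (sym_diff Q R))"
        using card_sym_diff_step[OF QR(1) b(4) 2] unfolding SR(2)[symmetric] .
      \<comment> \<open>The last step goes back towards \<open>Q\<close>, so \<open>\<rho>\<close>
        extended by \<open>S\<close> is reduced; aiming there makes the whole path end in
        \<open>R\<close>, \<open>S\<close>, \<open>R\<close>, ready for a nil move.\<close>
      have "geod Q S (\<rho> @ [S])" by (rule geod_snoc[OF snoc.prems(2) b(4) c' c])
      from moves_snoc[OF snoc.IH[OF b(2) this], of "[R]"]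
      have m: "moves (map rg (\<gamma> @ [R])) (map rg ((\<rho> @ [S]) @ [R]))" .
      have \<rho>: "\<rho> = butlast \<rho> @ [R]"
        using snoc.prems(2) unfolding geod_def tpath_def by (metis append_butlast_last_id)
      have "nil_move (map rg (butlast \<rho>) @ [rg R, rg S, rg R] @ []) (map rg (butlast \<rho>) @ [rg R] @ [])"
        by (rule nil_move.intros)
      moreover have "map rg (butlast \<rho>) @ [rg R, rg S, rg R] @ [] = map rg ((\<rho> @ [S]) @ [R])"
        by (subst (2) \<rho>) simp
      moreover have "map rg (butlast \<rho>) @ [rg R] @ [] = map rg \<rho>" by (subst (2) \<rho>) simp
      ultimately have "nil_move (map rg ((\<rho> @ [S]) @ [R])) (map rg \<rho>)" by (simp only:)
      then show ?thesis unfolding b(1) by (intro rtranclp.rtrancl_into_rtrancl[OF m] disjI2)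
    qed
  qed
qed

lemma path_convex_arrangement: "path_convex \<A>"
  unfolding path_convex_def
proof (intro ballI allI impI)
  fix Q' R' \<gamma> \<rho>
  assume "Q' \<in> regions \<A>" "R' \<in> regions \<A>" and g: "region_path \<A> Q' R' \<gamma>" and r: "reduced_path \<A> Q' R' \<rho>"
  then obtain Q R where QR: "Q \<in> topes" "R \<in> topes" "Q' = rg Q" "R' = rg R" unfolding regions_eq by blast
  have r': "region_path \<A> (rg Q) (rg R) \<rho>" using r QR by (simp add: reduced_path_def)
  obtain \<sigma> where s: "set \<sigma> \<subseteq> topes" "\<gamma> = map rg \<sigma>" using g unfolding QR by (rule lift_region_path)
  obtain \<tau> where t: "set \<tau> \<subseteq> topes" "\<rho> = map rg \<tau>" using r' by (rule lift_region_path)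
  have ts: "tpath Q R \<sigma>" using g region_path_rg[OF QR(1,2) s(1)] unfolding QR s by blast
  have tt: "tpath Q R \<tau>" using r' region_path_rg[OF QR(1,2) t(1)] unfolding t by blast
  obtain \<pi> where p: "geod Q R \<pi>" using exists_geod[OF QR(1,2)] by blast
  then have "region_path \<A> (rg Q) (rg R) (map rg \<pi>)"
    using region_path_rg[OF QR(1,2), of \<pi>] by (simp add: geod_def tpath_def)
  \<comment> \<open>Comparison with a path of length equal to the distance forces the reduced path
    to have that length too.\<close>
  then have "path_len \<rho> \<le> path_len (map rg \<pi>)" using r unfolding QR reduced_path_def by blast
  then have "length \<tau> \<le> Suc (card (sym_diff Q R))" using p unfolding t geod_def path_len_def by simp
  then have "geod Q R \<tau>" using tt tpath_length[OF tt] by (simp add: geod_def)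
  then show "moves \<gamma> \<rho>" using tpath_moves[OF ts] unfolding s t by blast
qed

end

theorem theorem3p1:
  fixes \<A> :: "(real ^ 'n) set set"
  assumes "hyperplane_arrangement \<A>"
  shows "path_convex \<A>"
proof -
  \<comment> \<open>Normal and offset are paired so that a single choice function provides
    both.\<close>
  from assms have fin: "finite \<A>" and "\<forall>H\<in>\<A>. \<exists>ab. fst ab \<noteq> 0 \<and> H = {x. fst ab \<bullet> x = snd ab}"
    by (auto simp: hyperplane_arrangement_def affine_hyperplane_def)
  then obtain f where f: "\<And>H. H \<in> \<A> \<Longrightarrow> fst (f H) \<noteq> 0 \<and> H = {x. fst (f H) \<bullet> x = snd (f H)}"
    by metis
  interpret arrangement \<A> "\<lambda>H. fst (f H)" "\<lambda>H. snd (f H)"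
    by unfold_locales (use fin f in auto)
  show ?thesis by (rule path_convex_arrangement)
qed

end
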